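(* Let $\mathfrak{O}$ be a complete discrete valuation ring with finite residue field. For every $n \in \mathbb{N}$ and every positive integer $D < 2n$, the image of any abstract group homomorphism $\varphi : \mathrm{SL}_n(\mathfrak{O}) \to \mathrm{GL}_D(\mathbb{R})$ is finite. Furthermore, if $\mathfrak{O}$ has positive characteristic, then for every $n \in \mathbb{N}$ and every positive integer $D$ (with no bound on $D$) the image of any abstract group homomorphism $\varphi : \mathrm{SL}_n(\mathfrak{O}) \to \mathrm{GL}_D(\mathbb{R})$ is finite.
   Context: "Abstract homomorphism" means a homomorphism of groups, with no continuity assumption. The characteristic of $\mathfrak{O}$ is its characteristic as a ring. $\mathbb{N}$ denotes the positive integers. *)

theory Defs
  imports
    "HOL-Algebra.Algebra"
    "HOL-Algebra.Algebraic_Closure_Type"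
    "Jordan_Normal_Form.Determinant"
begin

text \<open>
  A discrete valuation ring is a principal ideal domain with exactly one maximal ideal that is
  not a field. The locale \<^locale>\<open>principal_domain\<close> includes fields, so these are excluded
  explicitly.
\<close>

definition discrete_valuation_ring :: "('a, 'b) ring_scheme \<Rightarrow> bool" where
  "discrete_valuation_ring R \<longleftrightarrow>
     principal_domain R \<and> \<not> field R \<and> (\<exists>!M. maximalideal M R)"

text \<open>Only meaningful for local rings.\<close>

definition the_maximal_ideal :: "('a, 'b) ring_scheme \<Rightarrow> 'a set" where
  "the_maximal_ideal R = (THE M. maximalideal M R)"

definition ideal_power :: "('a, 'b) ring_scheme \<Rightarrow> 'a set \<Rightarrow> nat \<Rightarrow> 'a set" where
  "ideal_power R I k = I [^]\<^bsub>ideals_set R\<^esub> k"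

text \<open>
  Completeness in the \<open>I\<close>-adic topology. Sequences suffice because the
  topology is first countable. Separatedness is not part of this definition; for the maximal ideal
  of a discrete valuation ring it is automatic.
\<close>

definition adic_Cauchy :: "('a, 'b) ring_scheme \<Rightarrow> 'a set \<Rightarrow> (nat \<Rightarrow> 'a) \<Rightarrow> bool" where
  "adic_Cauchy R I x \<longleftrightarrow>
     (\<forall>k. \<exists>N. \<forall>i\<ge>N. \<forall>j\<ge>N. x i \<ominus>\<^bsub>R\<^esub> x j \<in> ideal_power R I k)"

definition adic_tendsto :: "('a, 'b) ring_scheme \<Rightarrow> 'a set \<Rightarrow> (nat \<Rightarrow> 'a) \<Rightarrow> 'a \<Rightarrow> bool" where
  "adic_tendsto R I x l \<longleftrightarrow>
     (\<forall>k. \<exists>N. \<forall>i\<ge>N. x i \<ominus>\<^bsub>R\<^esub> l \<in> ideal_power R I k)"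

definition adic_complete :: "('a, 'b) ring_scheme \<Rightarrow> 'a set \<Rightarrow> bool" where
  "adic_complete R I \<longleftrightarrow>
     (\<forall>x. range x \<subseteq> carrier R \<longrightarrow> adic_Cauchy R I x \<longrightarrow>
        (\<exists>l\<in>carrier R. adic_tendsto R I x l))"

definition complete_dvr_finite_residue_field :: "('a, 'b) ring_scheme \<Rightarrow> bool" where
  "complete_dvr_finite_residue_field R \<longleftrightarrow>
     discrete_valuation_ring R \<and>
     adic_complete R (the_maximal_ideal R) \<and>
     finite (carrier (R Quot the_maximal_ideal R))"

definition SL :: "nat \<Rightarrow> 'a :: comm_ring_1 mat monoid" where
  "SL n = \<lparr>carrier = {A \<in> carrier_mat n n. det A = 1}, monoid.mult = (*), one = 1\<^sub>m n\<rparr>"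

text \<open>The unit argument fills the unused extension slot of the ring record.\<close>

definition GL :: "nat \<Rightarrow> 'a :: comm_ring_1 mat monoid" where
  "GL n = units_of (ring_mat TYPE('a) n ())"

end

theory Submission
  imports
    Defs
    "HOL-Library.FuncSet"
    "HOL-Library.Function_Algebras"
    "HOL-Computational_Algebra.Fundamental_Theorem_Algebra"
    "HOL-Combinatorics.Transposition"
    "HOL-Number_Theory.Cong"
begin

text \<open>
  Write \<open>O\<close> for the ring. Over a local ring every matrix of determinant 1 is a product of boundedly
  many elementary matrices (\<open>bounded_elementary_generation\<close>), so \<open>\<phi>\<close> has finite image as soon as
  it has finite image on each root group \<open>E\<^sub>k\<^sub>l(x)\<close>, \<open>x \<in> O\<close>, which is a copy of the additive group
  of \<open>O\<close>.

  Let the group act on complex vectors of length \<open>D\<close>. The weights of a commuting family of operators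
  are the characters by which it acts on vectors modulo invariant subspaces; there are at most \<open>D\<close> of
  them (\<open>card_weights\<close>). The weights of a root group are torsion: in positive characteristic because
  \<open>O\<close> has finite exponent, and in general because the diagonal matrices normalise the root group and
  therefore permute its finitely many weights, while suitable ones multiply \<open>x\<close> by a power of an
  integer (\<open>weights_torsion\<close>). Hence the common kernel \<open>K\<close> of these weights has finite index in \<open>O\<close>,
  and only the action of \<open>K\<close> matters, which is unipotent.

  Suppose that \<open>K\<close> acts non-trivially. The first non-trivial layer of the filtration by fixed vectors
  gives a non-zero additive map \<open>s : K \<rightarrow> \<complex>\<close> which the diagonal matrices transform by a quotient
  \<open>\<psi>' / \<psi>\<close> of two of their own weights (\<open>additive_cocycle\<close>). In positive characteristic no such
  \<open>s\<close> exists, whatever \<open>D\<close> is.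

  In general choose an integer \<open>p \<ge> 2\<close> in the maximal ideal and, by successive approximation, a unit
  \<open>u\<close> with \<open>u\<^sup>2 = u - p\<close>. Let \<open>t\<^sub>i\<close> be the diagonal matrix with entry \<open>u\<^sup>n\<^sup>-\<^sup>1\<close> at \<open>i\<close> and
  \<open>u\<^sup>-\<^sup>1\<close> elsewhere. Conjugation by \<open>t\<^sub>k\<close> multiplies \<open>x\<close> by \<open>u\<^sup>n\<close>, so \<open>\<chi> = \<psi>'\<^sub>k / \<psi>\<^sub>k\<close> is a root of
  the quadratic polynomial with integer coefficients which \<open>u\<^sup>n\<close> satisfies. Its roots are a pair of
  conjugate numbers of modulus different from 1, none of whose positive powers is real
  (\<open>quadratic_root_power\<close>). They play the part of the values at \<open>u\<^sup>n\<close>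
  of a pair of conjugate embeddings of \<open>O\<close> into \<open>\<complex>\<close>.
  The weights of \<open>(t\<^sub>0, \<dots>, t\<^sub>n\<^sub>-\<^sub>1)\<close> are vectors in \<open>\<complex>\<^sup>n\<close>. They are permuted by the symmetric
  group, because monomial matrices lie in the group up to sign, and by complex conjugation, because
  \<open>\<phi>\<close> has real values. A set of vectors with entries of product 1 and with these symmetries
  which contains \<open>\<psi>\<close> and \<open>\<psi>'\<close> has at least \<open>2n\<close> elements (\<open>card_weights_lower_bound\<close>), so \<open>D \<ge> 2n\<close>.
\<close>

section \<open>Weights of commuting operators\<close>

text \<open>
  The space \<open>V\<close> is a subspace of an ambient vector space, so that its dimension can be a variable;
  \<open>B\<close> only bounds that dimension.
\<close>

locale bounded_space = vector_space scale
  for scale :: "complex \<Rightarrow> 'v::ab_group_add \<Rightarrow> 'v" +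
  fixes V B :: "'v set"
  assumes subspace_V: "subspace V" and finite_B: "finite B" and V_span: "V \<subseteq> span B"
begin

text \<open>
  Strict monotonicity of the dimension makes minimal and maximal invariant subspaces available.
\<close>

lemma dim_strict_mono:
  assumes "subspace P" "P \<subset> Q" "Q \<subseteq> V"
  shows "dim P < dim Q"
proof -
  obtain C where C: "C \<subseteq> P" "independent C" "P \<subseteq> span C" "card C = dim P"
    using basis_exists by blast
  obtain C' where C': "C' \<subseteq> Q" "independent C'" "Q \<subseteq> span C'" "card C' = dim Q"
    using basis_exists by blast
  have fin: "finite C" "finite C'"
    using independent_span_bound[OF finite_B, of C] independent_span_bound[OF finite_B, of C']
      C C' assms V_span by auto
  obtain y where y: "y \<in> Q" "y \<notin> P" using assms by blast
  have "span C \<subseteq> P" using C assms by (simp add: span_minimal)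
  then have y': "y \<notin> span C" using y by blast
  have "independent (insert y C)" using y' C independent_insertI by blast
  moreover have "insert y C \<subseteq> span C'" using y C C' assms by blast
  ultimately have "card (insert y C) \<le> card C'" using independent_span_bound[OF fin(2)] by blast
  moreover have "y \<notin> C" using y' span_base by blast
  ultimately show ?thesis using fin C C' by simp
qed

lemma dim_V_le: "dim V \<le> card B"
  using dim_le_card V_span finite_B by blast

definition operator :: "('v \<Rightarrow> 'v) \<Rightarrow> bool" where
  "operator f \<longleftrightarrow> (\<forall>x y. f (x + y) = f x + f y) \<and> (\<forall>c x. f (scale c x) = scale c (f x)) \<and> (\<forall>x\<in>V. f x \<in> V)"

definition invariant :: "('i \<Rightarrow> 'v \<Rightarrow> 'v) \<Rightarrow> 'v set \<Rightarrow> bool" where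
  "invariant A P \<longleftrightarrow> subspace P \<and> P \<subseteq> V \<and> (\<forall>i. \<forall>v\<in>P. A i v \<in> P)"

text \<open>
  Eigenvalues are taken modulo invariant subspaces, as a commuting family need not be diagonalisable.
  These are the diagonal entries in a simultaneous triangular form.
\<close>

definition weights :: "('i \<Rightarrow> 'v \<Rightarrow> 'v) \<Rightarrow> ('i \<Rightarrow> complex) set" where
  "weights A = {\<psi>. \<exists>P v. invariant A P \<and> v \<in> V - P \<and> (\<forall>i. A i v - scale (\<psi> i) v \<in> P)}"

definition commuting :: "('i \<Rightarrow> 'v \<Rightarrow> 'v) \<Rightarrow> bool" where
  "commuting A \<longleftrightarrow> (\<forall>i. operator (A i)) \<and> (\<forall>i j. \<forall>v\<in>V. A i (A j v) = A j (A i v))"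

lemma operator_diff: "operator f \<Longrightarrow> f (x - y) = f x - f y"
  unfolding operator_def by (metis add_diff_cancel diff_add_cancel)

lemma operator_0: "operator f \<Longrightarrow> f 0 = 0"
  using operator_diff[of f 0 0] by simp

text \<open>
  Some non-zero polynomial in \<open>f\<close> maps a vector \<open>v\<close> of \<open>Q\<close> outside \<open>P\<close> into \<open>P\<close>, because the vectors
  \<open>f\<^sup>i v\<close> are linearly dependent. In one of least degree split off a linear factor \<open>X - c\<close>: the
  cofactor does not yet map \<open>v\<close> into \<open>P\<close>, so it gives the eigenvector.
\<close>

lemma eigenvector_modulo:
  assumes f: "operator f" and P: "subspace P" and Q: "subspace Q" "\<And>x. x \<in> Q \<Longrightarrow> f x \<in> Q" "Q \<subseteq> V"
    and PQ: "P \<subset> Q"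
  shows "\<exists>v c. v \<in> Q - P \<and> f v - scale c v \<in> P"
proof -
  obtain v where v: "v \<in> Q" "v \<notin> P" using PQ by blast
  define act where "act p = (\<Sum>i\<le>degree p. scale (coeff p i) ((f ^^ i) v))" for p :: "complex poly"
  have act_bound: "act p = (\<Sum>i\<le>N. scale (coeff p i) ((f ^^ i) v))" if "degree p \<le> N" for p N
    unfolding act_def using that
    by (intro sum.mono_neutral_left) (auto simp: coeff_eq_0)
  have pow_Q: "(f ^^ i) v \<in> Q" for i
    using v Q by (induction i) auto
  have act_Q: "act p \<in> Q" for p
    unfolding act_def using Q pow_Q by (intro subspace_sum subspace_scale) auto
  have f_sum: "f (\<Sum>i\<in>I. scale (g i) (h i)) = (\<Sum>i\<in>I. scale (g i) (f (h i)))" for I :: "nat set" and g h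
  proof (induction I rule: infinite_finite_induct)
    case (insert x F)
    then show ?case using f by (simp add: operator_def)
  qed (use operator_0[OF f] in auto)
  have act_linear_factor: "act ([:- c, 1:] * q) = f (act q) - scale c (act q)" for c q
  proof -
    let ?N = "Suc (degree q)"
    have d: "degree ([:- c, 1:] * q) \<le> ?N"
      using degree_mult_le[of "[:- c, 1:]" q] by simp
    have e: "[:- c, 1:] * q = pCons 0 q - smult c q" by (simp add: mult_pCons_left)
    have "act ([:- c, 1:] * q) = (\<Sum>i\<le>?N. scale (coeff (pCons 0 q) i) ((f ^^ i) v))
        - (\<Sum>i\<le>?N. scale c (scale (coeff q i) ((f ^^ i) v)))"
      unfolding e act_bound[OF d[unfolded e]] by (simp add: scale_left_diff_distrib sum_subtractf del: sum.atMost_Suc)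
    also have "(\<Sum>i\<le>?N. scale c (scale (coeff q i) ((f ^^ i) v))) = scale c (act q)"
      by (simp add: scale_sum_right[symmetric] act_bound[of q ?N] del: sum.atMost_Suc scale_scale)
    also have "(\<Sum>i\<le>?N. scale (coeff (pCons 0 q) i) ((f ^^ i) v)) = f (act q)"
      unfolding act_def f_sum by (simp add: sum.atMost_Suc_shift del: sum.atMost_Suc)
    finally show ?thesis .
  qed
  have "\<exists>p. p \<noteq> 0 \<and> act p \<in> P"
  proof -
    let ?g = "\<lambda>i. (f ^^ i) v" and ?D = "card B"
    show ?thesis
    proof (cases "inj_on ?g {..?D}")
      case True
      let ?S = "?g ` {..?D}"
      have "card ?S = Suc ?D" using True by (simp add: card_image)
      moreover have "?S \<subseteq> span B" using pow_Q Q V_span by blast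
      ultimately have "dependent ?S"
        using independent_span_bound[OF finite_B, of ?S] by auto
      then obtain u y where u: "y \<in> ?S" "u y \<noteq> 0" "(\<Sum>w\<in>?S. scale (u w) w) = 0"
        using dependent_finite[of ?S] by auto
      obtain j where j: "j \<le> ?D" "y = ?g j" using u by auto
      define p where "p = Poly (map (\<lambda>i. u (?g i)) [0..<Suc ?D])"
      have cf: "coeff p i = (if i \<le> ?D then u (?g i) else 0)" for i
        unfolding p_def by (auto simp: nth_default_def simp del: upt_Suc)
      have "p \<noteq> 0" using cf[of j] j u by auto
      have "degree p \<le> ?D" by (rule degree_le) (simp add: cf)
      have "act p = (\<Sum>i\<le>?D. scale (u (?g i)) (?g i))"
        unfolding act_bound[OF \<open>degree p \<le> ?D\<close>] by (intro sum.cong) (auto simp: cf)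
      also have "\<dots> = (\<Sum>w\<in>?S. scale (u w) w)" using True by (simp add: sum.reindex)
      finally have "act p = 0" using u by simp
      then show ?thesis using \<open>p \<noteq> 0\<close> P subspace_0 by metis
    next
      case False
      then obtain i j where ij: "?g i = ?g j" "i \<noteq> j" by (auto simp: inj_on_def)
      define p :: "complex poly" where "p = monom 1 i - monom 1 j"
      have cf: "coeff p k = (if k = i then 1 else 0) - (if k = j then 1 else 0)" for k
        unfolding p_def by (auto simp: coeff_monom)
      have "p \<noteq> 0" using cf[of i] ij by auto
      have dg: "degree p \<le> i + j" by (rule degree_le) (auto simp: cf)
      have "act p = (\<Sum>k\<le>i+j. (if k = i then ?g k else 0) - (if k = j then ?g k else 0))"
        unfolding act_bound[OF dg] by (intro sum.cong) (auto simp: cf)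
      also have "\<dots> = 0" using ij by (simp add: sum_subtractf)
      finally show ?thesis using \<open>p \<noteq> 0\<close> P subspace_0 by metis
    qed
  qed
  then obtain p0 where "p0 \<noteq> 0 \<and> act p0 \<in> P" by blast
  from ex_has_least_nat[of "\<lambda>p. p \<noteq> 0 \<and> act p \<in> P", OF this, of degree]
  obtain p where p: "p \<noteq> 0" "act p \<in> P"
    and p_min: "\<And>q. q \<noteq> 0 \<Longrightarrow> act q \<in> P \<Longrightarrow> degree p \<le> degree q"
    by blast
  have "degree p \<noteq> 0"
  proof
    assume d: "degree p = 0"
    then obtain c where c: "p = [:c:]" by (metis degree_eq_zeroE)
    then have "scale c v \<in> P" "c \<noteq> 0" using p by (auto simp: act_def)
    then have "scale (inverse c) (scale c v) \<in> P" using P subspace_scale by blast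
    then show False using v \<open>c \<noteq> 0\<close> by simp
  qed
  then obtain c where "poly p c = 0"
    using fundamental_theorem_of_algebra[of p] by (auto simp: constant_degree)
  then obtain q where q: "p = [:- c, 1:] * q" by (metis dvdE poly_eq_0_iff_dvd)
  have "q \<noteq> 0" using p q by auto
  then have "degree p = Suc (degree q)" unfolding q by (subst degree_mult_eq) auto
  then have "act q \<notin> P" using p_min \<open>q \<noteq> 0\<close> by force
  then show ?thesis using act_Q p(2) act_linear_factor[of c q] q by auto
qed

text \<open>
  Choose \<open>R\<close> minimal among the invariant subspaces strictly between \<open>P\<close> and \<open>Q\<close>, with \<open>R = Q\<close>
  permitted. For each operator the eigenvectors modulo \<open>P\<close> for one of its eigenvalues form, together
  with \<open>P\<close>, an invariant subspace, hence all of \<open>R\<close>. So every operator is scalar on \<open>R\<close> modulo \<open>P\<close>.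
\<close>

lemma joint_eigenvector_modulo:
  assumes A: "commuting A" and P: "invariant A P" and Q: "invariant A Q" and PQ: "P \<subset> Q"
  shows "\<exists>v \<psi>. v \<in> Q - P \<and> (\<forall>i. A i v - scale (\<psi> i) v \<in> P)"
proof -
  have opA: "operator (A i)" for i using A by (simp add: commuting_def)
  have "invariant A Q \<and> P \<subset> Q \<and> Q \<subseteq> Q" using Q PQ by blast
  from ex_has_least_nat[of "\<lambda>R. invariant A R \<and> P \<subset> R \<and> R \<subseteq> Q", OF this, of dim]
  obtain R where R: "invariant A R" "P \<subset> R" "R \<subseteq> Q"
    and R_min: "\<And>R'. invariant A R' \<Longrightarrow> P \<subset> R' \<Longrightarrow> R' \<subseteq> Q \<Longrightarrow> dim R \<le> dim R'"
    by blast
  have "\<exists>c. \<forall>w\<in>R. A i w - scale c w \<in> P" for i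
  proof -
    obtain v c where v: "v \<in> R - P" "A i v - scale c v \<in> P"
      using eigenvector_modulo[OF opA[of i], of P R] P R unfolding invariant_def by blast
    define R' where "R' = {w \<in> R. A i w - scale c w \<in> P}"
    have sub: "subspace R" "subspace P" "R \<subseteq> V" using R P by (auto simp: invariant_def)
    have "subspace R'"
    proof (rule subspaceI)
      show "0 \<in> R'" using sub operator_0[OF opA[of i]] subspace_0 by (auto simp: R'_def)
      fix x y assume xy: "x \<in> R'" "y \<in> R'"
      have "A i (x + y) - scale c (x + y) = (A i x - scale c x) + (A i y - scale c y)"
        using opA[of i] by (simp add: operator_def scale_right_distrib algebra_simps)
      then show "x + y \<in> R'" using xy sub subspace_add by (simp add: R'_def)
    next
      fix d x assume x: "x \<in> R'"
      have "A i (scale d x) - scale c (scale d x) = scale d (A i x - scale c x)"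
        using opA[of i] by (simp add: operator_def scale_right_diff_distrib mult.commute)
      then show "scale d x \<in> R'" using x sub subspace_scale by (simp add: R'_def)
    qed
    moreover have "A j w \<in> R'" if w: "w \<in> R'" for j w
    proof -
      have "A i (A j w) - scale c (A j w) = A j (A i w - scale c w)"
        using A w sub opA[of j] operator_diff[OF opA[of j]]
        by (auto simp: commuting_def operator_def R'_def)
      then show ?thesis using w R P by (auto simp: R'_def invariant_def)
    qed
    ultimately have "invariant A R'" using sub by (auto simp: invariant_def R'_def)
    moreover have "P \<subseteq> R'"
    proof
      fix x assume "x \<in> P"
      then have "x \<in> R" "A i x \<in> P" "scale c x \<in> P"
        using R P sub subspace_scale by (auto simp: invariant_def)
      then show "x \<in> R'" using sub subspace_diff by (simp add: R'_def)
    qed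
    then have "P \<subset> R'" using v by (auto simp: R'_def)
    ultimately have "dim R \<le> dim R'" using R_min R by (auto simp: R'_def)
    then have "\<not> R' \<subset> R" using dim_strict_mono[of R' R] \<open>subspace R'\<close> sub by auto
    then have "R' = R" by (auto simp: R'_def)
    then show ?thesis by (auto simp: R'_def)
  qed
  then obtain \<psi> where "\<forall>i. \<forall>w\<in>R. A i w - scale (\<psi> i) w \<in> P" by metis
  then show ?thesis using R by blast
qed

lemma invariant_zero: "commuting A \<Longrightarrow> invariant A {0}"
  unfolding invariant_def commuting_def using operator_0 subspace_V subspace_0 by auto

lemma invariant_V: "commuting A \<Longrightarrow> invariant A V"
  unfolding invariant_def commuting_def operator_def using subspace_V by auto

lemma invariant_add_line:
  assumes A: "commuting A" and P: "invariant A P" and v: "v \<in> V"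
    and e: "\<forall>i. A i v - scale (\<psi> i) v \<in> P"
  shows "invariant A {x. \<exists>c. x - scale c v \<in> P}"
proof -
  have sub: "subspace P" using P by (simp add: invariant_def)
  have eq: "{x. \<exists>c. x - scale c v \<in> P} = span (insert v P)"
    using span_insert[of v P] sub by (simp add: span_eq_iff[THEN iffD2])
  have "A i x - scale (\<psi> i * c) v \<in> P" if x: "x - scale c v \<in> P" for i x c
  proof -
    have opA: "operator (A i)" using A by (simp add: commuting_def)
    have "A i x - scale (\<psi> i * c) v = A i (x - scale c v) + scale c (A i v - scale (\<psi> i) v)"
      using opA operator_diff[OF opA] by (simp add: operator_def scale_right_diff_distrib mult.commute)
    then show ?thesis using P x e sub by (simp add: invariant_def subspace_add subspace_scale)
  qed
  then have "\<forall>i. \<forall>x\<in>{x. \<exists>c. x - scale c v \<in> P}. A i x \<in> {x. \<exists>c. x - scale c v \<in> P}" by blast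
  moreover have "span (insert v P) \<subseteq> V"
    using v P subspace_V by (intro span_minimal) (auto simp: invariant_def)
  ultimately show ?thesis unfolding invariant_def by (simp add: eq subspace_span)
qed

text \<open>
  Induction on the dimension: a maximal proper invariant subspace \<open>P\<close> of \<open>Q\<close> has codimension 1, by
  existence of joint eigenvectors, and a weight of \<open>Q\<close> is a weight of \<open>P\<close> or the weight on \<open>Q\<close> modulo
  \<open>P\<close>.
\<close>

lemma weights_within_bound:
  assumes A: "commuting A" and "invariant A Q"
  shows "finite {\<psi>. \<exists>P v. invariant A P \<and> v \<in> Q - P \<and> (\<forall>i. A i v - scale (\<psi> i) v \<in> P)} \<and>
    card {\<psi>. \<exists>P v. invariant A P \<and> v \<in> Q - P \<and> (\<forall>i. A i v - scale (\<psi> i) v \<in> P)} \<le> dim Q"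
    (is "finite (?W Q) \<and> _")
  using assms(2)
proof (induction "dim Q" arbitrary: Q rule: less_induct)
  case less
  have subQ: "subspace Q" "Q \<subseteq> V" using less.prems by (auto simp: invariant_def)
  show ?case
  proof (cases "Q = {0}")
    case True
    have "0 \<in> P" if "invariant A P" for P using that subspace_0 by (auto simp: invariant_def)
    then have "?W Q = {}" using True by auto
    then show ?thesis by (metis card.empty finite.emptyI le0)
  next
    case False
    then have 0: "{0} \<subset> Q" using subQ subspace_0 by blast
    have Z: "invariant A {0} \<and> {0} \<subset> Q" using invariant_zero[OF A] 0 by blast
    have "\<forall>P. invariant A P \<and> P \<subset> Q \<longrightarrow> dim P < Suc (dim Q)"
      using dim_strict_mono subQ by (simp add: invariant_def less_SucI)
    from ex_has_greatest_nat[of "\<lambda>P. invariant A P \<and> P \<subset> Q", OF Z this]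
    obtain P where P: "invariant A P" "P \<subset> Q"
      and P_max: "\<And>P'. invariant A P' \<Longrightarrow> P' \<subset> Q \<Longrightarrow> dim P' \<le> dim P"
      by blast
    obtain w \<chi> where w: "w \<in> Q - P" "\<forall>i. A i w - scale (\<chi> i) w \<in> P"
      using joint_eigenvector_modulo[OF A P(1) less.prems P(2)] by blast
    have subP: "subspace P" using P by (simp add: invariant_def)
    let ?R = "{x. \<exists>c. x - scale c w \<in> P}"
    have R: "invariant A ?R" using invariant_add_line[OF A P(1), of w \<chi>] w subQ by blast
    have "?R \<subseteq> Q"
    proof safe
      fix x c assume "x - scale c w \<in> P"
      moreover have "scale c w \<in> Q" using w subQ subspace_scale by blast
      ultimately show "x \<in> Q" using P subQ subspace_add[of Q "x - scale c w" "scale c w"] by auto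
    qed
    moreover have PR: "P \<subset> ?R"
    proof -
      have "x - scale 0 w \<in> P" if "x \<in> P" for x using that by simp
      then have "P \<subseteq> ?R" by blast
      moreover have "w - scale 1 w \<in> P" using subP subspace_0 by simp
      then have "w \<in> ?R" by blast
      ultimately show ?thesis using w by blast
    qed
    moreover have "dim P < dim ?R"
      using dim_strict_mono[OF subP PR] R by (simp add: invariant_def)
    ultimately have RQ: "?R = Q" using P_max[OF R] by (meson leD psubsetI)
    have sub: "?W Q \<subseteq> insert \<chi> (?W P)"
    proof (rule subsetI, rule insertCI)
      fix \<psi>
      assume "\<psi> \<in> ?W Q" and new: "\<psi> \<notin> ?W P"
      then obtain P' v where P': "invariant A P'" "v \<in> Q" "v \<notin> P'" "\<forall>i. A i v - scale (\<psi> i) v \<in> P'"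
        by blast
      have subP': "subspace P'" using P' by (simp add: invariant_def)
      have opA: "operator (A i)" for i using A by (simp add: commuting_def)
      \<comment> \<open>The coset of \<open>v\<close> modulo \<open>P'\<close> misses \<open>P\<close>, as otherwise \<open>\<psi>\<close> would occur inside \<open>P\<close>.\<close>
      have miss: "v - x \<notin> P" if x: "x \<in> P'" for x
      proof
        assume vx: "v - x \<in> P"
        have "v - x \<notin> P'" using x P' subP' subspace_add[of P' "v - x" x] by auto
        moreover have "A i (v - x) - scale (\<psi> i) (v - x) \<in> P'" for i
        proof -
          have "A i (v - x) - scale (\<psi> i) (v - x) = (A i v - scale (\<psi> i) v) - (A i x - scale (\<psi> i) x)"
            using operator_diff[OF opA] by (simp add: scale_right_diff_distrib)
          moreover have "A i x - scale (\<psi> i) x \<in> P'"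
            using x P' subP' subspace_scale subspace_diff by (auto simp: invariant_def)
          ultimately show ?thesis using P' subP' subspace_diff by auto
        qed
        ultimately have "\<psi> \<in> ?W P" using P'(1) vx by blast
        then show False using new by simp
      qed
      obtain c where c: "v - scale c w \<in> P" using RQ P' by blast
      have "\<psi> i = \<chi> i" for i
      proof (rule ccontr)
        assume ne: "\<psi> i \<noteq> \<chi> i"
        have "A i v - scale (\<chi> i) v = (A i (v - scale c w) - scale (\<chi> i) (v - scale c w))
            + scale c (A i w - scale (\<chi> i) w)"
          using operator_diff[OF opA] opA[of i]
          by (simp add: operator_def scale_right_diff_distrib mult.commute)
        then have 1: "A i v - scale (\<chi> i) v \<in> P"
          using P c w subP subspace_scale subspace_diff subspace_add by (auto simp: invariant_def)
        define d where "d = \<psi> i - \<chi> i"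
        have "scale d v = (A i v - scale (\<chi> i) v) - (A i v - scale (\<psi> i) v)"
          by (simp add: d_def scale_left_diff_distrib)
        then have "scale (inverse d) (scale d v) =
            scale (inverse d) (A i v - scale (\<chi> i) v) - scale (inverse d) (A i v - scale (\<psi> i) v)"
          by (simp add: scale_right_diff_distrib)
        moreover have "scale (inverse d) (scale d v) = v" using ne by (simp add: d_def)
        ultimately have "v - scale (inverse d) (- (A i v - scale (\<psi> i) v)) = scale (inverse d) (A i v - scale (\<chi> i) v)"
          by (simp only: scale_minus_right) (simp add: algebra_simps)
        then have "v - scale (inverse d) (- (A i v - scale (\<psi> i) v)) \<in> P"
          using 1 subP subspace_scale by simp
        moreover have "scale (inverse d) (- (A i v - scale (\<psi> i) v)) \<in> P'"
          using P' subP' subspace_scale subspace_neg by blast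
        ultimately show False using miss by blast
      qed
      then show "\<psi> = \<chi>" by blast
    qed
    have lt: "dim P < dim Q" using dim_strict_mono[OF subP P(2)] subQ by blast
    have IH: "finite (?W P)" "card (?W P) \<le> dim P" using less.hyps[OF lt P(1)] by auto
    have "finite (insert \<chi> (?W P))" using IH by blast
    then have fin: "finite (?W Q)" using sub by (rule rev_finite_subset)
    have "card (?W Q) \<le> card (insert \<chi> (?W P))" using sub IH by (intro card_mono) auto
    also have "\<dots> \<le> Suc (card (?W P))" by (rule card_insert_le_m1) auto
    finally show ?thesis using fin lt IH by linarith
  qed
qed

lemma
  assumes "commuting A"
  shows finite_weights: "finite (weights A)"
    and card_weights: "card (weights A) \<le> card B"
  using weights_within_bound[OF assms invariant_V[OF assms]] dim_V_le unfolding weights_def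
  by simp_all

text \<open>
  Symmetries of a family of operators permute its weights. The map \<open>G\<close> may be semilinear, so that this
  covers both conjugation by group elements (\<open>\<kappa>\<close> the identity) and complex conjugation.
\<close>

lemma weights_semilinear_image:
  assumes wt: "\<psi> \<in> weights A"
    and G: "\<And>x y. G (x + y) = G x + G y" "\<And>c x. G (scale c x) = scale (\<kappa> c) (G x)"
    and GV: "\<And>v. v \<in> V \<Longrightarrow> G v \<in> V" "inj_on G V" and \<kappa>: "surj \<kappa>"
    and GA: "\<And>i v. v \<in> V \<Longrightarrow> G (A (\<tau> i) v) = A' i (G v)"
  shows "(\<lambda>i. \<kappa> (\<psi> (\<tau> i))) \<in> weights A'"
proof -
  obtain P v where P: "invariant A P" "v \<in> V - P" "\<forall>i. A i v - scale (\<psi> i) v \<in> P"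
    using wt by (auto simp: weights_def)
  have PV: "P \<subseteq> V" and subP: "subspace P" using P by (auto simp: invariant_def)
  have G_diff: "G (x - y) = G x - G y" for x y by (metis G(1) add_diff_cancel diff_add_cancel)
  have "subspace (G ` P)"
  proof (rule subspaceI)
    show "0 \<in> G ` P" using G_diff[of 0 0] subP subspace_0 by (metis cancel_comm_monoid_add_class.diff_cancel imageI)
    show "x + y \<in> G ` P" if "x \<in> G ` P" "y \<in> G ` P" for x y
      using that subP subspace_add by (auto simp: G(1)[symmetric])
    show "scale c x \<in> G ` P" if x: "x \<in> G ` P" for c x
    proof -
      obtain d where "c = \<kappa> d" using \<kappa> by (metis surjD)
      then show ?thesis using x subP subspace_scale by (auto simp: G(2)[symmetric])
    qed
  qed
  moreover have "A' i y \<in> G ` P" if "y \<in> G ` P" for i y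
  proof -
    obtain x where "y = G x" "x \<in> P" using \<open>y \<in> G ` P\<close> by blast
    then have "A' i (G x) = G (A (\<tau> i) x)" "A (\<tau> i) x \<in> P" using P PV GA by (auto simp: invariant_def)
    then show ?thesis using \<open>y = G x\<close> by simp
  qed
  ultimately have "invariant A' (G ` P)" using PV GV by (auto simp: invariant_def)
  moreover have "G v \<in> V - G ` P"
  proof -
    have "G v \<notin> G ` P"
    proof
      assume "G v \<in> G ` P"
      then obtain x where "x \<in> P" "G v = G x" by blast
      then have "v = x" using GV PV P by (meson DiffD1 inj_onD subsetD)
      then show False using \<open>x \<in> P\<close> P by simp
    qed
    then show ?thesis using P GV by blast
  qed
  moreover have "A' i (G v) - scale (\<kappa> (\<psi> (\<tau> i))) (G v) \<in> G ` P" for i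
    using P by (simp add: GA[symmetric] G(2)[symmetric] G_diff[symmetric])
  ultimately show ?thesis by (auto simp: weights_def)
qed

subsection \<open>Operators indexed by a ring\<close>

lemma weight_multiplicative:
  fixes U :: "'a::ab_group_add \<Rightarrow> 'v \<Rightarrow> 'v"
  assumes U: "commuting U" and hom: "\<And>x y v. v \<in> V \<Longrightarrow> U (x + y) v = U x (U y v)"
    and one: "\<And>v. v \<in> V \<Longrightarrow> U 0 v = v" and \<mu>: "\<mu> \<in> weights U"
  shows "\<mu> (x + y) = \<mu> x * \<mu> y" and "\<mu> 0 = 1"
proof -
  obtain P v where P: "invariant U P" "v \<in> V - P" "\<forall>i. U i v - scale (\<mu> i) v \<in> P"
    using \<mu> by (auto simp: weights_def)
  have sub: "subspace P" using P by (simp add: invariant_def)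
  have cancel: "c = d" if "scale c v - scale d v \<in> P" for c d
  proof (rule ccontr)
    assume "c \<noteq> d"
    have "scale (inverse (c - d)) (scale c v - scale d v) \<in> P" using that sub subspace_scale by blast
    then show False using P \<open>c \<noteq> d\<close> by (simp add: scale_left_diff_distrib[symmetric])
  qed
  have opU: "operator (U i)" for i using U by (simp add: commuting_def)
  have "scale (\<mu> x * \<mu> y) v - scale (\<mu> (x + y)) v =
      (U (x + y) v - scale (\<mu> (x + y)) v) - U x (U y v - scale (\<mu> y) v)
      - scale (\<mu> y) (U x v - scale (\<mu> x) v)"
    using operator_diff[OF opU] opU hom P
    by (simp add: operator_def scale_right_diff_distrib mult.commute)
  also have "\<dots> \<in> P"
  proof (rule subspace_diff[OF sub subspace_diff[OF sub] subspace_scale[OF sub]])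
    show "U x (U y v - scale (\<mu> y) v) \<in> P" using P by (simp add: invariant_def)
  qed (use P in blast)+
  finally show "\<mu> (x + y) = \<mu> x * \<mu> y" using cancel by metis
  have "scale 1 v - scale (\<mu> 0) v \<in> P" using P one[of v] P(3)[rule_format, of 0] by simp
  then show "\<mu> 0 = 1" using cancel by metis
qed

text \<open>
  For a homomorphism \<open>U\<close> this is an additive subgroup on which 1 is the only eigenvalue of each \<open>U x\<close>.
\<close>

definition unipotent_part :: "('a::comm_ring_1 \<Rightarrow> 'v \<Rightarrow> 'v) \<Rightarrow> 'a set" where
  "unipotent_part U = {x. \<forall>\<mu>\<in>weights U. \<mu> x = 1}"

text \<open>
  If the weights are torsion then they take finitely many values, so the unipotent part, their common
  kernel, has finite index.
\<close>

lemma finite_range_if_trivial_on_unipotent_part: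
  fixes U :: "'a::comm_ring_1 \<Rightarrow> 'v \<Rightarrow> 'v"
  assumes U: "commuting U" and hom: "\<And>x y v. v \<in> V \<Longrightarrow> U (x + y) v = U x (U y v)"
    and one: "\<And>v. v \<in> V \<Longrightarrow> U 0 v = v"
    and torsion: "\<And>\<mu>. \<mu> \<in> weights U \<Longrightarrow> \<exists>M>0. \<forall>x. \<mu> x ^ M = 1"
    and trivial: "\<And>x v. x \<in> unipotent_part U \<Longrightarrow> v \<in> V \<Longrightarrow> U x v = v"
  shows "finite (range (\<lambda>x. restrict (U x) V))"
proof -
  have mult: "\<mu> (x + y) = \<mu> x * \<mu> y" "\<mu> 0 = 1" if "\<mu> \<in> weights U" for \<mu> x y
    using weight_multiplicative[OF U hom one that] by simp_all
  define g where "g x = restrict (\<lambda>\<mu>. \<mu> x) (weights U)" for x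
  define M where "M \<mu> = (SOME m. m > 0 \<and> (\<forall>x. \<mu> x ^ m = 1))" for \<mu> :: "'a \<Rightarrow> complex"
  have M: "M \<mu> > 0" "\<mu> x ^ M \<mu> = 1" if "\<mu> \<in> weights U" for \<mu> x
    unfolding M_def using someI_ex[OF torsion[OF that]] by auto
  have "range g \<subseteq> PiE (weights U) (\<lambda>\<mu>. {z. z ^ M \<mu> = 1})"
    using M by (auto simp: g_def)
  moreover have "finite (PiE (weights U) (\<lambda>\<mu>. {z::complex. z ^ M \<mu> = 1}))"
    using finite_weights[OF U] M finite_roots_unity by (intro finite_PiE) (auto simp: Suc_le_eq)
  ultimately have fin: "finite (range g)" using finite_subset by blast
  have eq: "restrict (U x) V = restrict (U y) V" if "g x = g y" for x y
  proof -
    have "\<mu> (x - y) = 1" if \<mu>: "\<mu> \<in> weights U" for \<mu>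
    proof -
      have "\<mu> x = \<mu> y" using \<open>g x = g y\<close> \<mu> by (metis g_def restrict_apply')
      moreover have "\<mu> x = \<mu> (x - y) * \<mu> y" using mult(1)[OF \<mu>, of "x - y" y] by simp
      moreover have "\<mu> y * \<mu> (- y) = 1" using mult[OF \<mu>] by (metis add.right_inverse)
      ultimately show ?thesis by auto
    qed
    then have "x - y \<in> unipotent_part U" by (simp add: unipotent_part_def)
    moreover have "U y v \<in> V" if "v \<in> V" for v using U that by (simp add: commuting_def operator_def)
    ultimately have "U x v = U y v" if "v \<in> V" for v
      using trivial hom[OF that, of "x - y" y] that by simp
    then show ?thesis by (rule restrict_ext)
  qed
  have "range (\<lambda>x. restrict (U x) V) \<subseteq> (\<lambda>c. restrict (U (SOME x. g x = c)) V) ` range g"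
  proof safe
    fix x
    have "g (SOME y. g y = g x) = g x" by (rule someI) simp
    then show "restrict (U x) V \<in> (\<lambda>c. restrict (U (SOME x. g x = c)) V) ` range g"
      by (intro image_eqI[where x = "g x"] eq[symmetric]) auto
  qed
  then show ?thesis using fin finite_surj by blast
qed

text \<open>
  Since \<open>T\<close> conjugates \<open>U x\<close> to \<open>U (m x)\<close>, the finite set of weights is closed under
  \<open>\<mu> \<mapsto> \<mu>(m\<^sup>-\<^sup>1 x)\<close>. By the pigeonhole principle \<open>\<mu>(m\<^sup>d x) = \<mu>(x)\<close> for some \<open>d > 0\<close>, that is,
  \<open>\<mu>(x)\<close> is a root of unity of order dividing \<open>m\<^sup>d - 1\<close>.
\<close>

lemma weights_torsion:
  fixes U :: "'a::comm_ring_1 \<Rightarrow> 'v \<Rightarrow> 'v" and c :: 'a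
  assumes U: "commuting U" and hom: "\<And>x y v. v \<in> V \<Longrightarrow> U (x + y) v = U x (U y v)"
    and one: "\<And>v. v \<in> V \<Longrightarrow> U 0 v = v"
    and m: "m \<ge> 2" "c * of_nat m = 1"
    and T: "operator T" "inj_on T V" and TU: "\<And>x v. v \<in> V \<Longrightarrow> T (U x v) = U (of_nat m * x) (T v)"
    and \<mu>: "\<mu> \<in> weights U"
  shows "\<exists>M>0. \<forall>x. \<mu> x ^ M = 1"
proof -
  have mult: "\<mu> (x + y) = \<mu> x * \<mu> y" "\<mu> 0 = 1" if "\<mu> \<in> weights U" for \<mu> x y
    using weight_multiplicative[OF U hom one that] by simp_all
  have step: "(\<lambda>x. \<mu> (c * x)) \<in> weights U" if "\<mu> \<in> weights U" for \<mu> :: "'a \<Rightarrow> complex"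
  proof -
    have "(\<lambda>x. id (\<mu> (c * x))) \<in> weights U"
    proof (rule weights_semilinear_image[OF that, of T])
      fix x v assume "v \<in> V"
      then have "T (U (c * x) v) = U ((c * of_nat m) * x) (T v)" by (simp only: TU mult_ac)
      then show "T (U (c * x) v) = U x (T v)" using m by simp
    qed (use T in \<open>auto simp: operator_def\<close>)
    then show ?thesis by simp
  qed
  define f where "f k = (\<lambda>x. \<mu> (c ^ k * x))" for k :: nat
  have "f k \<in> weights U" for k
  proof (induction k)
    case (Suc k)
    have "f (Suc k) = (\<lambda>x. f k (c * x))" by (simp add: f_def mult_ac)
    then show ?case using step[OF Suc] by simp
  qed (use \<mu> in \<open>simp add: f_def\<close>)
  then have "\<not> inj f"
    using finite_weights[OF U] finite_subset[of "range f"] finite_imageD infinite_UNIV_nat by blast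
  then obtain i j where "i \<noteq> j" "f i = f j" by (auto simp: inj_def)
  then obtain i j where ij: "i < j" "f i = f j" by (metis linorder_neqE_nat)
  have nat: "\<mu> (of_nat k * x) = \<mu> x ^ k" for k x
    by (induction k) (simp_all add: mult[OF \<mu>] distrib_right)
  have pw: "c ^ k * of_nat m ^ k = 1" for k using m by (simp add: power_mult_distrib[symmetric])
  let ?d = "m ^ (j - i)"
  have "\<mu> x ^ (?d - 1) = 1" for x
  proof -
    have "\<mu> x = f j (of_nat m ^ j * x)" by (simp add: f_def mult.assoc[symmetric] pw)
    also have "\<dots> = \<mu> (c ^ i * (of_nat m ^ (i + (j - i)) * x))"
      using ij by (simp add: f_def fun_eq_iff)
    also have "\<dots> = \<mu> ((c ^ i * of_nat m ^ i) * (of_nat ?d * x))"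
      by (simp only: power_add of_nat_power mult_ac)
    also have "\<dots> = \<mu> x ^ ?d" by (simp only: pw nat mult_1_left)
    finally have 1: "\<mu> x = \<mu> x ^ ?d" .
    have "\<mu> x * \<mu> (- x) = 1" using mult[OF \<mu>] by (metis add.right_inverse)
    then have "\<mu> x \<noteq> 0" by auto
    moreover have "\<mu> x ^ ?d = \<mu> x ^ (?d - 1) * \<mu> x"
      using m by (subst power_Suc2[symmetric]) simp
    ultimately show ?thesis using 1 by simp
  qed
  moreover have "?d - 1 > 0" using ij m one_less_power[of m "j - i"] by simp
  ultimately show ?thesis by blast
qed

text \<open>
  Let \<open>V1\<close> be the space of vectors fixed by \<open>K\<close>, and let \<open>V2\<close> be the space of vectors fixed by \<open>K\<close>
  modulo \<open>V1\<close>. For \<open>w \<in> V2\<close> the map \<open>x \<mapsto> U x w - w\<close> is a homomorphism from \<open>K\<close> to the additive group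
  \<open>V1\<close>. Taking for \<open>w\<close> a joint eigenvector of \<open>T\<close> modulo \<open>V1\<close>, with weight \<open>\<psi>\<close>, makes this
  homomorphism equivariant; projecting it to a one-dimensional \<open>T\<close>-subquotient of \<open>V1\<close>, of weight
  \<open>\<psi>'\<close>, on which it does not vanish gives \<open>s\<close>.
\<close>

lemma additive_cocycle:
  fixes U :: "'a::comm_ring_1 \<Rightarrow> 'v \<Rightarrow> 'v" and T :: "'i \<Rightarrow> 'v \<Rightarrow> 'v" and \<alpha> :: "'i \<Rightarrow> 'a"
  assumes U: "commuting U" and hom: "\<And>x y v. v \<in> V \<Longrightarrow> U (x + y) v = U x (U y v)"
    and one: "\<And>v. v \<in> V \<Longrightarrow> U 0 v = v"
    and T: "commuting T" and TU: "\<And>i x v. v \<in> V \<Longrightarrow> T i (U x v) = U (\<alpha> i * x) (T i v)"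
  defines "K \<equiv> unipotent_part U"
  assumes K: "\<And>i. (\<lambda>x. \<alpha> i * x) ` K = K"
    and nontrivial: "x0 \<in> K" "v0 \<in> V" "U x0 v0 \<noteq> v0"
  shows "\<exists>\<psi>\<in>weights T. \<exists>\<psi>'\<in>weights T. \<exists>s. (\<forall>x\<in>K. \<forall>y\<in>K. s (x + y) = s x + s y) \<and> (\<exists>x\<in>K. s x \<noteq> 0) \<and>
    (\<forall>i. \<forall>x\<in>K. \<psi>' i * s x = \<psi> i * s (\<alpha> i * x))"
proof -
  have mult: "\<mu> (x + y) = \<mu> x * \<mu> y" "\<mu> 0 = 1" if "\<mu> \<in> weights U" for \<mu> x y
    using weight_multiplicative[OF U hom one that] by simp_all
  have opU: "operator (U x)" for x using U by (simp add: commuting_def)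
  have opT: "operator (T i)" for i using T by (simp add: commuting_def)
  have comm: "U x (U y v) = U y (U x v)" if "v \<in> V" for x y v using U that by (simp add: commuting_def)
  have UV: "U x v \<in> V" "T i v \<in> V" if "v \<in> V" for x i v using opU opT that by (auto simp: operator_def)
  have K_add: "x + y \<in> K" if "x \<in> K" "y \<in> K" for x y
    using that unfolding K_def unipotent_part_def by (auto simp: mult(1))
  have K_\<alpha>: "\<alpha> i * x \<in> K" if "x \<in> K" for x i using imageI[OF that, of "\<lambda>x. \<alpha> i * x"] K by simp
  have K_surj: "\<exists>y\<in>K. x = \<alpha> i * y" if "x \<in> K" for x i
  proof -
    have "x \<in> (\<lambda>x. \<alpha> i * x) ` K" using K that by simp
    then show ?thesis by blast
  qed
  define V1 where "V1 = {v \<in> V. \<forall>x\<in>K. U x v = v}"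
  have sub1: "subspace V1"
    using subspace_V opU operator_0[OF opU] unfolding V1_def subspace_def operator_def by simp
  have inv1U: "invariant U V1"
    using sub1 UV unfolding invariant_def by (simp add: V1_def) (metis comm)
  have T1: "T i v \<in> V1" if v: "v \<in> V1" for i v
  proof -
    have "U x (T i v) = T i v" if "x \<in> K" for x
    proof -
      obtain y where y: "y \<in> K" "x = \<alpha> i * y" using K_surj[OF \<open>x \<in> K\<close>, of i] by blast
      then show ?thesis using TU[of v i y] v by (simp add: V1_def)
    qed
    then show ?thesis using v UV by (simp add: V1_def)
  qed
  have inv1T: "invariant T V1" using sub1 T1 by (auto simp: invariant_def V1_def)
  have "V1 \<subset> V" using nontrivial by (auto simp: V1_def)
  then obtain v1 \<mu> where v1: "v1 \<in> V - V1" "\<forall>x. U x v1 - scale (\<mu> x) v1 \<in> V1"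
    using joint_eigenvector_modulo[OF U inv1U invariant_V[OF U]] by blast
  have "\<mu> \<in> weights U" using v1 inv1U by (auto simp: weights_def)
  then have v1': "U x v1 - v1 \<in> V1" if "x \<in> K" for x
  proof -
    have "\<mu> x = 1" using \<open>\<mu> \<in> weights U\<close> that by (simp add: K_def unipotent_part_def)
    then show ?thesis using v1(2)[rule_format, of x] by simp
  qed
  \<comment> \<open>A joint eigenvector of \<open>U\<close> modulo \<open>V1\<close> has a weight, and weights are 1 on \<open>K\<close>; so \<open>V1 \<noteq> V2\<close>.\<close>
  define V2 where "V2 = {v \<in> V. \<forall>x\<in>K. U x v - v \<in> V1}"
  have sub2: "subspace V2"
  proof (rule subspaceI)
    show "0 \<in> V2" using sub1 subspace_0 subspace_V operator_0[OF opU] by (simp add: V2_def)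
    fix x y assume xy: "x \<in> V2" "y \<in> V2"
    have e: "U z (x + y) - (x + y) = (U z x - x) + (U z y - y)" for z
      using opU by (simp add: operator_def)
    show "x + y \<in> V2" using xy sub1 subspace_V by (simp add: V2_def e subspace_add)
  next
    fix c x assume x: "x \<in> V2"
    have e: "U z (scale c x) - scale c x = scale c (U z x - x)" for z
      using opU by (simp add: operator_def scale_right_diff_distrib)
    show "scale c x \<in> V2" using x sub1 subspace_V by (simp add: V2_def e subspace_scale)
  qed
  have "T i v \<in> V2" if v: "v \<in> V2" for i v
  proof -
    have "U x (T i v) - T i v \<in> V1" if "x \<in> K" for x
    proof -
      obtain y where y: "y \<in> K" "x = \<alpha> i * y" using K_surj[OF \<open>x \<in> K\<close>, of i] by blast
      then have "U x (T i v) - T i v = T i (U y v - v)"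
        using TU[of v i y] v operator_diff[OF opT] by (simp add: V2_def)
      then show ?thesis using v y T1 by (simp add: V2_def)
    qed
    then show ?thesis using v UV by (simp add: V2_def)
  qed
  then have inv2T: "invariant T V2" using sub2 by (auto simp: invariant_def V2_def)
  have "0 \<in> V1" using sub1 subspace_0 by blast
  then have "V1 \<subseteq> V2" by (auto simp: V1_def V2_def)
  moreover have "v1 \<in> V2" using v1 v1' by (simp add: V2_def)
  ultimately have "V1 \<subset> V2" using v1 by blast
  then obtain w \<psi> where w: "w \<in> V2 - V1" "\<forall>i. T i w - scale (\<psi> i) w \<in> V1"
    using joint_eigenvector_modulo[OF T inv1T inv2T] by blast
  have wV: "w \<in> V" using w by (simp add: V2_def)
  have \<psi>: "\<psi> \<in> weights T" using w wV inv1T by (auto simp: weights_def)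
  define b where "b x = U x w - w" for x
  have b1: "b x \<in> V1" if "x \<in> K" for x using w that by (simp add: b_def V2_def)
  have b_add: "b (x + y) = b x + b y" if "x \<in> K" "y \<in> K" for x y
  proof -
    have "b (x + y) = U x (b y) + b x" using wV hom operator_diff[OF opU] by (simp add: b_def)
    then show ?thesis using b1[OF that(2)] that by (simp add: V1_def)
  qed
  have Tb: "T i (b x) = scale (\<psi> i) (b (\<alpha> i * x))" if "x \<in> K" for i x
  proof -
    let ?d = "T i w - scale (\<psi> i) w"
    have "U (\<alpha> i * x) ?d = ?d" using w K_\<alpha> that by (simp add: V1_def)
    then have "U (\<alpha> i * x) (T i w) - scale (\<psi> i) (U (\<alpha> i * x) w) = ?d"
      using operator_diff[OF opU] opU by (simp add: operator_def)
    then have "U (\<alpha> i * x) (T i w) - T i w = scale (\<psi> i) (U (\<alpha> i * x) w) - scale (\<psi> i) w"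
      by (simp add: algebra_simps)
    moreover have "T i (b x) = U (\<alpha> i * x) (T i w) - T i w"
      using TU wV operator_diff[OF opT] by (simp add: b_def)
    ultimately show ?thesis by (simp add: b_def scale_right_diff_distrib)
  qed
  have "\<exists>x\<in>K. b x \<noteq> 0" using w wV by (auto simp: b_def V1_def)
  then have Z: "invariant T {0} \<and> \<not> b ` K \<subseteq> {0}" using invariant_zero[OF T] by blast
  \<comment> \<open>Enlarging a maximal \<open>P\<close> that misses part of the image of \<open>b\<close> by one eigenvector \<open>v'\<close> captures
    the whole image; the coefficient of \<open>v'\<close> is the map wanted.\<close>
  have "\<forall>P. invariant T P \<and> \<not> b ` K \<subseteq> P \<longrightarrow> dim P < Suc (dim V)"
    using dim_strict_mono[of _ V] by (auto simp: invariant_def less_Suc_eq psubset_eq)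
  from ex_has_greatest_nat[of "\<lambda>P. invariant T P \<and> \<not> b ` K \<subseteq> P", OF Z this]
  obtain P where P: "invariant T P" "\<not> b ` K \<subseteq> P"
    and P_max: "\<And>P'. invariant T P' \<Longrightarrow> \<not> b ` K \<subseteq> P' \<Longrightarrow> dim P' \<le> dim P"
    by blast
  have subP: "subspace P" using P by (simp add: invariant_def)
  have "P \<subset> V" using P b1 by (auto simp: invariant_def V1_def)
  then obtain v' \<psi>' where v': "v' \<in> V - P" "\<forall>i. T i v' - scale (\<psi>' i) v' \<in> P"
    using joint_eigenvector_modulo[OF T P(1) invariant_V[OF T]] by blast
  have \<psi>': "\<psi>' \<in> weights T" using v' P by (auto simp: weights_def)
  let ?R = "{x. \<exists>c. x - scale c v' \<in> P}"
  have R: "invariant T ?R" using invariant_add_line[OF T P(1) _ v'(2)] v' by blast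
  have "x - scale 0 v' \<in> P" if "x \<in> P" for x using that by simp
  then have "P \<subseteq> ?R" by blast
  moreover have "v' - scale 1 v' \<in> P" using subP subspace_0 by simp
  then have "v' \<in> ?R" by blast
  ultimately have "P \<subset> ?R" using v' by blast
  then have "dim P < dim ?R" using dim_strict_mono[OF subP] R by (simp add: invariant_def)
  then have bR: "b ` K \<subseteq> ?R" using P_max[OF R] by linarith
  have cancel: "c = d" if "scale c v' - scale d v' \<in> P" for c d
  proof (rule ccontr)
    assume "c \<noteq> d"
    have "scale (inverse (c - d)) (scale c v' - scale d v') \<in> P" using that subP subspace_scale by blast
    then show False using v' \<open>c \<noteq> d\<close> by (simp add: scale_left_diff_distrib[symmetric])
  qed
  define s where "s x = (SOME c. b x - scale c v' \<in> P)" for x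
  have s: "b x - scale (s x) v' \<in> P" if "x \<in> K" for x
  proof -
    have "\<exists>c. b x - scale c v' \<in> P" using bR that by blast
    then show ?thesis unfolding s_def by (rule someI_ex)
  qed
  have "s (x + y) = s x + s y" if xy: "x \<in> K" "y \<in> K" for x y
  proof (rule cancel)
    have "scale (s (x + y)) v' - scale (s x + s y) v' =
        (b x - scale (s x) v') + (b y - scale (s y) v') - (b (x + y) - scale (s (x + y)) v')"
      using b_add[OF xy] by (simp add: scale_left_distrib)
    also have "\<dots> \<in> P" 
      by (rule subspace_diff[OF subP subspace_add[OF subP s[OF xy(1)] s[OF xy(2)]] s[OF K_add[OF xy]]])
    finally show "scale (s (x + y)) v' - scale (s x + s y) v' \<in> P" .
  qed
  moreover have "\<exists>x\<in>K. s x \<noteq> 0"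
  proof -
    obtain x where "x \<in> K" "b x \<notin> P" using P by blast
    then have "s x \<noteq> 0" using s[of x] by auto
    then show ?thesis using \<open>x \<in> K\<close> by blast
  qed
  moreover have "\<psi>' i * s x = \<psi> i * s (\<alpha> i * x)" if x: "x \<in> K" for i x
  proof (rule cancel)
    have 1: "T i (b x - scale (s x) v') \<in> P" using P(1) s[OF x] by (simp add: invariant_def)
    have 2: "T i (b x - scale (s x) v') = scale (\<psi> i) (b (\<alpha> i * x)) - scale (s x) (T i v')"
      using Tb[OF x] operator_diff[OF opT] opT by (simp add: operator_def)
    have "scale (\<psi>' i * s x) v' - scale (\<psi> i * s (\<alpha> i * x)) v' =
        scale (\<psi> i) (b (\<alpha> i * x) - scale (s (\<alpha> i * x)) v')
        - (scale (\<psi> i) (b (\<alpha> i * x)) - scale (s x) (T i v')) - scale (s x) (T i v' - scale (\<psi>' i) v')"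
      by (simp add: scale_right_diff_distrib mult.commute)
    also have "\<dots> \<in> P"
      by (rule subspace_diff[OF subP subspace_diff[OF subP subspace_scale[OF subP s[OF K_\<alpha>[OF x]]]
              1[unfolded 2]] subspace_scale[OF subP v'(2)[rule_format]]])
    finally show "scale (\<psi>' i * s x) v' - scale (\<psi> i * s (\<alpha> i * x)) v' \<in> P" .
  qed
  ultimately show ?thesis using \<psi> \<psi>' by blast
qed

text \<open>
  A product relation between the operators, with \<open>F m\<close> the product of the first \<open>m\<close> of them, is
  inherited by the weights.
\<close>

lemma weights_prod_eq_1:
  assumes A: "commuting A" and \<psi>: "\<psi> \<in> weights A"
    and F: "\<And>v. v \<in> V \<Longrightarrow> F 0 v = v" "\<And>m v. v \<in> V \<Longrightarrow> F (Suc m) v = A m (F m v)"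
      "\<And>v. v \<in> V \<Longrightarrow> F n v = v"
  shows "(\<Prod>i<n. \<psi> i) = 1"
proof -
  obtain P v where P: "invariant A P" "v \<in> V - P" "\<forall>i. A i v - scale (\<psi> i) v \<in> P"
    using \<psi> by (auto simp: weights_def)
  have sub: "subspace P" using P by (simp add: invariant_def)
  have opA: "operator (A i)" for i using A by (simp add: commuting_def)
  have "F m v - scale (\<Prod>i<m. \<psi> i) v \<in> P" for m
  proof (induction m)
    case 0
    then show ?case using F(1) P sub subspace_0 by simp
  next
    case (Suc m)
    let ?c = "\<Prod>i<m. \<psi> i"
    have "F (Suc m) v - scale (\<Prod>i<Suc m. \<psi> i) v =
        A m (F m v - scale ?c v) + scale ?c (A m v - scale (\<psi> m) v)"
      using F(2) P operator_diff[OF opA] opA[of m]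
      by (simp add: operator_def scale_right_diff_distrib mult.commute)
    moreover have "A m (F m v - scale ?c v) \<in> P" using Suc P(1) by (simp add: invariant_def)
    ultimately show ?case using P(3) sub by (simp add: subspace_add subspace_scale)
  qed
  from this[of n] have "v - scale (\<Prod>i<n. \<psi> i) v \<in> P" using F(3) P by simp
  then have "scale (1 - (\<Prod>i<n. \<psi> i)) v \<in> P" by (simp add: scale_left_diff_distrib)
  then have "scale (inverse (1 - (\<Prod>i<n. \<psi> i))) (scale (1 - (\<Prod>i<n. \<psi> i)) v) \<in> P"
    using sub subspace_scale by blast
  then show ?thesis using P(2) by (cases "1 - (\<Prod>i<n. \<psi> i) = 0") auto
qed

end

section \<open>Counting weights\<close>

text \<open>
  The fibre \<open>A\<close> of \<open>f\<close> through \<open>a\<close> misses \<open>b\<close>. Transpositions that exchange a point of \<open>A\<close> with one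
  outside change \<open>f\<close>, and all of them change it differently. Moving \<open>a\<close> to each point outside \<open>A\<close>, or
  \<open>b\<close> to each point of \<open>A\<close> other than \<open>a\<close>, gives \<open>n - 1\<close> functions besides \<open>f\<close> itself.
\<close>

lemma distinct_transposed_functions:
  fixes f :: "nat \<Rightarrow> 'c"
  assumes a: "a < n" and b: "b < n" and ab: "f a \<noteq> f b"
  obtains p q where "\<And>k. k < n \<Longrightarrow> p k < n \<and> q k < n"
    and "inj_on (\<lambda>k. f \<circ> transpose (p k) (q k)) {..<n}"
proof -
  define p where "p k = (if f k = f a then k else a)" for k
  define q where "q k = (if k = a then a else if f k = f a then b else k)" for k
  \<comment> \<open>If \<open>k = a\<close> then \<open>t k\<close> is the identity.\<close>
  define t where "t k = transpose (p k) (q k)" for k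
  have t_own: "f (t k k) = (if k = a then f a else if f k = f a then f b else f a)" for k
    by (simp add: t_def p_def q_def)
  have t_other: "f (t k l) = f l" if "l \<noteq> k" "l \<noteq> a" "f k \<noteq> f a \<or> k = a \<or> l \<noteq> b" for k l
    using that by (auto simp: t_def p_def q_def transpose_def)
  have "t k \<noteq> t l \<and> f (t k k) \<noteq> f (t l k)"
    if "k \<noteq> l" "k \<noteq> a" "f k = f a \<or> f l \<noteq> f a \<or> l = a" for k l
  proof -
    have "f (t k k) \<noteq> f k" using t_own[of k] that ab by metis
    moreover have "f (t l k) = f k" using t_other[of k l] that ab by metis
    ultimately show ?thesis by metis
  qed
  then have differ: "f \<circ> t k \<noteq> f \<circ> t l"
    if "k \<noteq> l" "k \<noteq> a" "f k = f a \<or> f l \<noteq> f a \<or> l = a" for k l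
    using that by (metis comp_apply)
  have "f \<circ> t k \<noteq> f \<circ> t l" if "k \<noteq> l" for k l
    using differ[of k l] differ[of l k] that by metis
  then have "inj_on (\<lambda>k. f \<circ> transpose (p k) (q k)) {..<n}"
    unfolding t_def by (intro inj_onI) metis
  moreover have "p k < n \<and> q k < n" if "k < n" for k using that a b by (auto simp: p_def q_def)
  ultimately show ?thesis using that by blast
qed

lemma card_ge_double:
  assumes "finite S" and "\<And>k. k < n \<Longrightarrow> g k \<in> S" "\<And>k. k < n \<Longrightarrow> h k \<in> S"
    and "inj_on g {..<n}" "inj_on h {..<n}" "\<And>k l. k < n \<Longrightarrow> l < n \<Longrightarrow> g k \<noteq> h l"
  shows "2 * n \<le> card S"
proof -
  have "card (g ` {..<n} \<union> h ` {..<n}) = card (g ` {..<n}) + card (h ` {..<n})"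
    using assms(6) by (intro card_Un_disjoint) auto
  also have "\<dots> = 2 * n" using assms by (simp add: card_image)
  finally have "card (g ` {..<n} \<union> h ` {..<n}) = 2 * n" .
  moreover have "card (g ` {..<n} \<union> h ` {..<n}) \<le> card S" using assms by (intro card_mono) auto
  ultimately show ?thesis by simp
qed

lemma comp_transpose_cancel: "f \<circ> transpose i j = g \<circ> transpose i j \<longleftrightarrow> f = g"
  by (auto simp: fun_eq_iff) (metis transpose_involutory)

text \<open>
  By \<open>distinct_transposed_functions\<close> a non-constant weight has at least \<open>n\<close> images under transpositions. If a
  non-real weight has moduli that are not all equal, then \<open>n\<close> images that differ already in their
  moduli, together with their complex conjugates, are \<open>2n\<close> weights. Otherwise each weight is real or
  unitary, the latter because the product of its entries is 1. The weights \<open>\<psi>\<close> and \<open>\<psi>'\<close> are not both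
  real and not both unitary, by the two properties of \<open>\<chi>\<close>, so one of them is real and the other one
  is unitary and not real. Both are non-constant and have disjoint orbits.
\<close>

lemma card_weights_lower_bound:
  fixes S :: "(nat \<Rightarrow> complex) set"
  assumes fin: "finite S"
    and swap: "\<And>\<psi> i j. \<psi> \<in> S \<Longrightarrow> i < n \<Longrightarrow> j < n \<Longrightarrow> \<psi> \<circ> transpose i j \<in> S"
    and conj: "\<And>\<psi>. \<psi> \<in> S \<Longrightarrow> cnj \<circ> \<psi> \<in> S"
    and prod1: "\<And>\<psi>. \<psi> \<in> S \<Longrightarrow> (\<Prod>i<n. \<psi> i) = 1"
    and \<psi>: "\<psi> \<in> S" "\<psi>' \<in> S" "a < n" "\<psi>' a = \<chi> * \<psi> a"
    and \<chi>: "cmod \<chi> \<noteq> 1" "\<chi> ^ n \<notin> \<real>"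
  shows "2 * n \<le> card S"
proof (cases "\<exists>\<rho>\<in>S. cnj \<circ> \<rho> \<noteq> \<rho> \<and> (\<exists>b<n. \<exists>c<n. cmod (\<rho> b) \<noteq> cmod (\<rho> c))")
  case True
  then obtain \<rho> b c where \<rho>: "\<rho> \<in> S" "cnj \<circ> \<rho> \<noteq> \<rho>" and bc: "b < n" "c < n" "(cmod \<circ> \<rho>) b \<noteq> (cmod \<circ> \<rho>) c"
    by auto
  obtain p q where pq: "\<And>k. k < n \<Longrightarrow> p k < n \<and> q k < n"
    and inj: "inj_on (\<lambda>k. (cmod \<circ> \<rho>) \<circ> transpose (p k) (q k)) {..<n}"
    using distinct_transposed_functions[OF bc] by blast
  define g where "g k = \<rho> \<circ> transpose (p k) (q k)" for k
  have mod_g: "cmod \<circ> g k = (cmod \<circ> \<rho>) \<circ> transpose (p k) (q k)" "cmod \<circ> (cnj \<circ> g k) = cmod \<circ> g k" for k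
    by (auto simp: g_def)
  have inj': "k = l" if "cmod \<circ> g k = cmod \<circ> g l" "k < n" "l < n" for k l
    using inj that unfolding mod_g inj_on_def by auto
  show ?thesis
  proof (rule card_ge_double[OF fin, where g = g and h = "\<lambda>k. cnj \<circ> g k"])
    show "g k \<in> S" if "k < n" for k using swap[OF \<rho>(1)] pq[OF that] by (simp add: g_def)
    then show "cnj \<circ> g k \<in> S" if "k < n" for k using conj that by blast
    show "inj_on g {..<n}" by (rule inj_onI) (use inj' in auto)
    show "inj_on (\<lambda>k. cnj \<circ> g k) {..<n}"
    proof (rule inj_onI)
      fix k l assume kl: "cnj \<circ> g k = cnj \<circ> g l" "k \<in> {..<n}" "l \<in> {..<n}"
      have "cmod \<circ> g k = cmod \<circ> g l" using mod_g(2)[of k] mod_g(2)[of l] kl(1) by simp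
      then show "k = l" using inj' kl by simp
    qed
    show "g k \<noteq> cnj \<circ> g l" if "k < n" "l < n" for k l
    proof
      assume eq: "g k = cnj \<circ> g l"
      then have "cmod \<circ> g k = cmod \<circ> g l" using mod_g(2)[of l] by simp
      then have "k = l" using inj' that by simp
      then have "\<rho> \<circ> transpose (p k) (q k) = (cnj \<circ> \<rho>) \<circ> transpose (p k) (q k)"
        using eq by (simp add: g_def comp_assoc)
      then show False using \<rho>(2) unfolding comp_transpose_cancel by simp
    qed
  qed
next
  case False
  have unit: "cmod (\<rho> i) = 1" if \<rho>: "\<rho> \<in> S" "cnj \<circ> \<rho> \<noteq> \<rho>" and i: "i < n" for \<rho> i
  proof -
    have "cmod (\<rho> j) = cmod (\<rho> i)" if "j < n" for j using False \<rho> i that by blast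
    then have "(\<Prod>j<n. cmod (\<rho> j)) = cmod (\<rho> i) ^ n" by simp
    moreover have "(\<Prod>j<n. cmod (\<rho> j)) = 1" using prod1[OF \<rho>(1)] by (metis norm_one prod_norm)
    ultimately have "cmod (\<rho> i) ^ n = 1 ^ n" by simp
    then show ?thesis using i power_eq_imp_eq_base[of "cmod (\<rho> i)" n 1] by auto
  qed
  \<comment> \<open>One real weight of non-constant modulus and one non-real unitary weight give two disjoint orbits.\<close>
  have two_orbits: "2 * n \<le> card S"
    if \<rho>: "\<rho> \<in> S" "cnj \<circ> \<rho> = \<rho>" and \<eta>: "\<eta> \<in> S" "cnj \<circ> \<eta> \<noteq> \<eta>"
      and \<omega>: "\<eta> a = \<omega> * \<rho> a" "cmod \<omega> \<noteq> 1" "\<omega> ^ n \<notin> \<real>" for \<rho> \<eta> \<omega>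
  proof -
    have real: "\<rho> i \<in> \<real>" for i using fun_cong[OF \<rho>(2), of i] by (simp add: Reals_cnj_iff)
    have \<rho>a: "\<rho> a \<noteq> 0" "cmod (\<rho> a) \<noteq> 1"
      using unit[OF \<eta> \<psi>(3)] \<omega> by (auto simp: norm_mult)
    have "\<exists>b<n. \<rho> a \<noteq> \<rho> b"
    proof (rule ccontr)
      assume "\<not> ?thesis"
      then have "(\<Prod>i<n. \<rho> i) = (\<Prod>i<n. \<rho> a)" by (intro prod.cong) auto
      then have "(\<Prod>i<n. \<rho> i) = \<rho> a ^ n" by simp
      then have "cmod (\<rho> a) ^ n = 1 ^ n" using prod1[OF \<rho>(1)] by (metis norm_one norm_power power_one)
      then show False using \<rho>a \<psi>(3) power_eq_imp_eq_base[of "cmod (\<rho> a)" n 1] by auto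
    qed
    then obtain b where b: "b < n" "\<rho> a \<noteq> \<rho> b" by blast
    \<comment> \<open>A constant weight has \<open>n\<close>-th roots of unity as entries, so \<open>\<omega>\<^sup>n\<close> would be real.\<close>
    have "\<exists>c<n. \<eta> a \<noteq> \<eta> c"
    proof (rule ccontr)
      assume "\<not> ?thesis"
      then have "(\<Prod>i<n. \<eta> i) = (\<Prod>i<n. \<eta> a)" by (intro prod.cong) auto
      then have "(\<Prod>i<n. \<eta> i) = \<eta> a ^ n" by simp
      then have "\<omega> ^ n * \<rho> a ^ n = 1" using prod1[OF \<eta>(1)] \<omega>(1) by (simp add: power_mult_distrib)
      then have "\<omega> ^ n = inverse (\<rho> a ^ n)" using inverse_unique[of "\<rho> a ^ n" "\<omega> ^ n"] by (simp add: mult.commute)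
      then show False using \<omega>(3) real by (auto intro!: Reals_inverse)
    qed
    then obtain c where c: "c < n" "\<eta> a \<noteq> \<eta> c" by blast
    obtain p q where pq: "\<And>k. k < n \<Longrightarrow> p k < n \<and> q k < n"
      and inj: "inj_on (\<lambda>k. \<rho> \<circ> transpose (p k) (q k)) {..<n}"
      using distinct_transposed_functions[OF \<psi>(3) b] by blast
    obtain r s where rs: "\<And>k. k < n \<Longrightarrow> r k < n \<and> s k < n"
      and inj': "inj_on (\<lambda>k. \<eta> \<circ> transpose (r k) (s k)) {..<n}"
      using distinct_transposed_functions[OF \<psi>(3) c] by blast
    show ?thesis
    proof (rule card_ge_double[OF fin _ _ inj inj'])
      show "\<rho> \<circ> transpose (p k) (q k) \<noteq> \<eta> \<circ> transpose (r l) (s l)" for k l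
      proof
        assume eq: "\<rho> \<circ> transpose (p k) (q k) = \<eta> \<circ> transpose (r l) (s l)"
        have "(cnj \<circ> \<eta>) \<circ> transpose (r l) (s l) = (cnj \<circ> \<rho>) \<circ> transpose (p k) (q k)"
          using eq by (simp add: comp_assoc)
        also have "\<dots> = \<eta> \<circ> transpose (r l) (s l)" using \<rho> eq by simp
        finally show False using \<eta>(2) unfolding comp_transpose_cancel by simp
      qed
    qed (use swap pq rs \<rho> \<eta> in auto)
  qed
  have "\<chi> \<noteq> 0" using \<chi>(2) \<psi>(3) by (auto simp: power_0_left)
  have nz: "\<rho> a \<noteq> 0" if "\<rho> \<in> S" for \<rho> using prod1[OF that] \<psi>(3) prod_zero[of "{..<n}" \<rho>] by auto
  show ?thesis
  proof (cases "cnj \<circ> \<psi> = \<psi>"; cases "cnj \<circ> \<psi>' = \<psi>'")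
    assume "cnj \<circ> \<psi> = \<psi>" "cnj \<circ> \<psi>' = \<psi>'"
    then have "\<psi> a \<in> \<real>" "\<psi>' a \<in> \<real>" by (auto simp: Reals_cnj_iff fun_eq_iff)
    moreover have "\<chi> = \<psi>' a / \<psi> a" using \<psi> nz by simp
    ultimately show ?thesis using \<chi>(2) by simp
  next
    assume "cnj \<circ> \<psi> = \<psi>" "cnj \<circ> \<psi>' \<noteq> \<psi>'"
    then show ?thesis using two_orbits \<psi> \<chi> by blast
  next
    assume r: "cnj \<circ> \<psi> \<noteq> \<psi>" "cnj \<circ> \<psi>' = \<psi>'"
    have "\<psi> a = inverse \<chi> * \<psi>' a" using \<psi>(4) \<open>\<chi> \<noteq> 0\<close> by simp
    moreover have "cmod (inverse \<chi>) \<noteq> 1" using \<chi>(1) by (simp add: norm_inverse)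
    moreover have "inverse \<chi> ^ n \<notin> \<real>"
      using \<chi>(2) Reals_inverse_iff[of "\<chi> ^ n"] by (simp add: power_inverse)
    ultimately show ?thesis using two_orbits[OF \<psi>(2) r(2) \<psi>(1) r(1)] by blast
  next
    assume "cnj \<circ> \<psi> \<noteq> \<psi>" "cnj \<circ> \<psi>' \<noteq> \<psi>'"
    then have "cmod (\<psi> a) = 1" "cmod (\<psi>' a) = 1" using unit \<psi> by blast+
    then show ?thesis using \<psi>(4) \<chi>(1) by (simp add: norm_mult)
  qed
qed

section \<open>Powers of the roots of a quadratic polynomial\<close>

text \<open>
  The sums \<open>a\<^sup>k + b\<^sup>k\<close> for the two roots \<open>a\<close> and \<open>b\<close> of \<open>X\<^sup>2 - X + p\<close>.
\<close>

fun power_trace :: "int \<Rightarrow> nat \<Rightarrow> int" where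
  "power_trace p 0 = 2"
| "power_trace p (Suc 0) = 1"
| "power_trace p (Suc (Suc k)) = power_trace p (Suc k) - p * power_trace p k"

lemma power_trace:
  fixes a b :: "'a::comm_ring_1"
  assumes "a + b = 1" "a * b = of_int p"
  shows "a ^ k + b ^ k = of_int (power_trace p k)"
  using assms
proof (induction p k rule: power_trace.induct)
  case (3 p k)
  have "a ^ Suc (Suc k) + b ^ Suc (Suc k) = (a + b) * (a ^ Suc k + b ^ Suc k) - (a * b) * (a ^ k + b ^ k)"
    by (simp add: algebra_simps)
  then show ?case using 3 by simp
qed auto

lemma power_trace_cong_1: "k \<ge> 1 \<Longrightarrow> [power_trace p k = 1] (mod p)"
  by (induction p k rule: power_trace.induct) (auto simp: cong_def mod_diff_eq[symmetric])

text \<open>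
  The hypothesis says that \<open>\<chi>\<close> is \<open>z\<^sup>n\<close> or its conjugate, where \<open>z\<close> is a complex root of
  \<open>X\<^sup>2 - X + p\<close>, of modulus \<open>\<surd>p\<close>. If a power \<open>z\<^sup>k\<close> were real, the square of the trace of \<open>z\<^sup>k\<close>
  would be \<open>4 p\<^sup>k\<close>, whereas the trace is 1 modulo \<open>p\<close>.
\<close>

lemma quadratic_root_power:
  fixes \<chi> :: complex
  assumes p: "p \<ge> 2" and n: "n \<ge> 1"
    and \<chi>: "\<chi>\<^sup>2 - of_int (power_trace (int p) n) * \<chi> + of_nat p ^ n = 0"
  shows "cmod \<chi> \<noteq> 1" and "m \<ge> 1 \<Longrightarrow> \<chi> ^ m \<notin> \<real>"
proof -
  define z where "z = Complex (1/2) (sqrt (real p - 1/4))"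
  have z: "z + cnj z = 1" "z * cnj z = of_nat p"
    using p by (simp_all add: z_def complex_eq_iff power2_eq_square[symmetric] power_divide)
  have trace: "z ^ k + cnj z ^ k = of_int (power_trace (int p) k)" for k
    using power_trace[of z "cnj z" "int p" k] z by simp
  have "(\<chi> - z ^ n) * (\<chi> - cnj z ^ n) = \<chi>\<^sup>2 - (z ^ n + cnj z ^ n) * \<chi> + (z * cnj z) ^ n"
    by (simp add: algebra_simps power2_eq_square power_mult_distrib)
  also have "\<dots> = 0" using \<chi> by (simp only: trace z)
  finally have \<chi>_cases: "\<chi> = z ^ n \<or> \<chi> = cnj (z ^ n)" by simp
  have "complex_of_real ((cmod z)\<^sup>2) = of_nat p" by (simp only: complex_norm_square z)
  then have "(cmod z)\<^sup>2 = real p" by (metis of_real_eq_iff of_real_of_nat_eq)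
  then have "1\<^sup>2 < (cmod z)\<^sup>2" using p by simp
  then have "cmod z > 1" by (rule power_less_imp_less_base) simp
  then have "cmod z ^ n > 1" using n by (simp add: one_less_power)
  then show "cmod \<chi> \<noteq> 1" using \<chi>_cases by (auto simp: norm_power)
  assume m: "m \<ge> 1"
  show "\<chi> ^ m \<notin> \<real>"
  proof
    let ?k = "n * m"
    assume "\<chi> ^ m \<in> \<real>"
    then have "z ^ ?k \<in> \<real>"
      using \<chi>_cases by (auto simp: power_mult Reals_cnj_iff)
    then have "cnj z ^ ?k = z ^ ?k" by (simp add: Reals_cnj_iff)
    then have 1: "of_int (power_trace (int p) ?k) = 2 * z ^ ?k" using trace[of ?k] by simp
    have "(of_int (power_trace (int p) ?k))\<^sup>2 = 4 * (z ^ ?k * cnj z ^ ?k)"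
      unfolding 1 \<open>cnj z ^ ?k = z ^ ?k\<close> by (simp add: power2_eq_square)
    also have "\<dots> = of_int (4 * int p ^ ?k)" by (simp add: power_mult_distrib[symmetric] z)
    finally have "(power_trace (int p) ?k)\<^sup>2 = 4 * int p ^ ?k" by (metis of_int_eq_iff of_int_power)
    moreover have "[(power_trace (int p) ?k)\<^sup>2 = 1\<^sup>2] (mod int p)"
      using power_trace_cong_1[of ?k] m n by (intro cong_pow) simp
    moreover have "int p dvd 4 * int p ^ ?k" using m n by (simp add: dvd_power)
    ultimately have "int p dvd 1" by (simp add: cong_dvd_iff)
    then show False using p by simp
  qed
qed

section \<open>Complete discrete valuation rings with finite residue field\<close>

context
  assumes dvr: "complete_dvr_finite_residue_field (ring_of_type_algebra :: 'a :: idom ring)"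
begin

abbreviation (input) \<O> :: "'a ring" where "\<O> \<equiv> ring_of_type_algebra"
abbreviation (input) \<mm> :: "'a set" where "\<mm> \<equiv> the_maximal_ideal \<O>"

lemma R_simps:
  "carrier \<O> = UNIV" "x \<otimes>\<^bsub>\<O>\<^esub> y = x * y" "x \<oplus>\<^bsub>\<O>\<^esub> y = x + y" "\<one>\<^bsub>\<O>\<^esub> = 1" "\<zero>\<^bsub>\<O>\<^esub> = 0"
  by (simp_all add: ring_of_type_algebra_def)

lemma R_principal: "principal_domain \<O>"
  using dvr by (simp add: complete_dvr_finite_residue_field_def discrete_valuation_ring_def)

lemma R_minus: "x \<ominus>\<^bsub>\<O>\<^esub> y = x - y"
proof -
  interpret principal_domain \<O> by (rule R_principal)
  have "(x \<ominus>\<^bsub>\<O>\<^esub> y) \<oplus>\<^bsub>\<O>\<^esub> y = x"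
    using l_neg[of y] by (simp add: R_simps minus_eq a_assoc del: l_neg)
  then show ?thesis by (simp add: R_simps eq_diff_eq)
qed

lemma \<mm>_maximal: "maximalideal \<mm> \<O>"
  using dvr theI'[of "\<lambda>M. maximalideal M \<O>"] unfolding the_maximal_ideal_def
  by (simp add: complete_dvr_finite_residue_field_def discrete_valuation_ring_def)

lemma \<mm>_unique: "maximalideal M \<O> \<Longrightarrow> M = \<mm>"
  using dvr \<mm>_maximal by (auto simp: complete_dvr_finite_residue_field_def discrete_valuation_ring_def)

lemma \<mm>_ideal: "ideal \<mm> \<O>"
  using \<mm>_maximal by (simp add: maximalideal_def)

lemma \<mm>_add: "x \<in> \<mm> \<Longrightarrow> y \<in> \<mm> \<Longrightarrow> x + y \<in> \<mm>"
  and \<mm>_mult: "x \<in> \<mm> \<Longrightarrow> z * x \<in> \<mm>"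
  and \<mm>_0: "0 \<in> \<mm>"
  and \<mm>_1: "1 \<notin> \<mm>"
proof -
  interpret ideal \<mm> \<O> by (rule \<mm>_ideal)
  show "x \<in> \<mm> \<Longrightarrow> y \<in> \<mm> \<Longrightarrow> x + y \<in> \<mm>" using additive_subgroup.a_closed[OF ideal.axioms(1)[OF \<mm>_ideal], of x y] by (simp add: R_simps)
  show "x \<in> \<mm> \<Longrightarrow> z * x \<in> \<mm>" using I_l_closed[of x z] by (simp add: R_simps)
  show "0 \<in> \<mm>" using additive_subgroup.zero_closed[OF ideal.axioms(1)[OF \<mm>_ideal]] by (simp add: R_simps)
  show "1 \<notin> \<mm>"
    using one_imp_carrier maximalideal.I_notcarr[OF \<mm>_maximal] by (auto simp: R_simps)
qed

lemma unit_if_not_in_\<mm>: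
  assumes "x \<notin> \<mm>" shows "x dvd 1"
proof (rule ccontr)
  assume nonunit: "\<not> x dvd 1"
  interpret principal_domain \<O> by (rule R_principal)
  have "x \<noteq> 0" using assms \<mm>_0 by auto
  then have x: "x \<in> carrier \<O> - {\<zero>\<^bsub>\<O>\<^esub>}" by (simp add: R_simps)
  have "x \<notin> Units \<O>" using nonunit by (auto simp: Units_def R_simps dvd_def)
  then obtain q where q: "q \<in> carrier \<O>" "ring_irreducible\<^bsub>\<O>\<^esub> q" "q divides\<^bsub>\<O>\<^esub> x"
    using exists_irreducible_divisor[OF x] by blast
  then have "PIdl\<^bsub>\<O>\<^esub> q = \<mm>" using irreducible_imp_maximalideal[of q] \<mm>_unique by (simp add: R_simps)
  moreover obtain c where "x = q * c" using q by (auto simp: factor_def R_simps)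
  then have "x \<in> PIdl\<^bsub>\<O>\<^esub> q" by (auto simp: cgenideal_def R_simps mult.commute)
  ultimately show False using assms by simp
qed

lemma local_ring: "x + y dvd (1::'a) \<Longrightarrow> x dvd 1 \<or> y dvd 1"
proof (rule ccontr)
  assume u: "x + y dvd 1" and "\<not> (x dvd 1 \<or> y dvd 1)"
  then have "x + y \<in> \<mm>" using unit_if_not_in_\<mm> \<mm>_add by blast
  moreover obtain z where "1 = z * (x + y)" using u by (auto simp: dvd_def mult.commute)
  ultimately show False using \<mm>_mult \<mm>_1 by metis
qed

text \<open>
  Two natural numbers agree in the finite residue field. Their difference is not 1, as the maximal
  ideal is proper.
\<close>

lemma nat_in_\<mm>: "\<exists>p\<ge>2. of_nat p \<in> \<mm>"
proof -
  interpret ideal \<mm> \<O> by (rule \<mm>_ideal)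
  let ?c = "\<lambda>k::nat. \<mm> +>\<^bsub>\<O>\<^esub> of_nat k"
  have "range ?c \<subseteq> carrier (\<O> Quot \<mm>)"
    by (auto simp: FactRing_def A_RCOSETS_def' R_simps)
  moreover have "finite (carrier (\<O> Quot \<mm>))"
    using dvr by (simp add: complete_dvr_finite_residue_field_def)
  ultimately have "\<not> inj ?c" using finite_subset finite_imageD infinite_UNIV_nat by blast
  then obtain i j where "i \<noteq> j" "?c i = ?c j" by (auto simp: inj_def)
  then obtain i j where ij: "i < j" "?c i = ?c j" by (metis linorder_neqE_nat)
  have "of_nat j \<in> ?c j" using a_rcos_self[of "of_nat j"] by (simp add: R_simps)
  then have "of_nat j \<in> ?c i" using ij by simp
  then obtain h where "h \<in> \<mm>" "of_nat j = h + of_nat i" by (auto simp: a_r_coset_def' R_simps)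
  then have *: "of_nat (j - i) \<in> \<mm>" using ij by (simp add: of_nat_diff)
  then have "j - i \<noteq> 1" using \<mm>_1 by (metis of_nat_1)
  then have "j - i \<ge> 2" using ij by linarith
  then show ?thesis using * by blast
qed

lemma \<mm>_power_0: "ideal_power \<O> \<mm> 0 = UNIV"
  and \<mm>_power_Suc: "ideal_power \<O> \<mm> (Suc k) = ideal_prod \<O> (ideal_power \<O> \<mm> k) \<mm>"
  by (simp_all add: ideal_power_def ideals_set_def nat_pow_def R_simps)

lemma \<mm>_power_ideal: "ideal (ideal_power \<O> \<mm> k) \<O>"
proof (induction k)
  interpret ring \<O> using \<mm>_ideal by (simp add: ideal_def)
  case 0
  show ?case using oneideal by (simp add: \<mm>_power_0 R_simps)
next
  interpret ring \<O> using \<mm>_ideal by (simp add: ideal_def)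
  case (Suc k)
  then show ?case using ideal_prod_is_ideal \<mm>_ideal by (simp add: \<mm>_power_Suc)
qed

lemma \<mm>_power_closed:
  "x \<in> ideal_power \<O> \<mm> k \<Longrightarrow> y \<in> ideal_power \<O> \<mm> k \<Longrightarrow> x + y \<in> ideal_power \<O> \<mm> k"
  "x \<in> ideal_power \<O> \<mm> k \<Longrightarrow> z * x \<in> ideal_power \<O> \<mm> k"
  "0 \<in> ideal_power \<O> \<mm> k"
proof -
  interpret ideal "ideal_power \<O> \<mm> k" \<O> by (rule \<mm>_power_ideal)
  show "x \<in> ideal_power \<O> \<mm> k \<Longrightarrow> y \<in> ideal_power \<O> \<mm> k \<Longrightarrow> x + y \<in> ideal_power \<O> \<mm> k"
    using additive_subgroup.a_closed[OF ideal.axioms(1)[OF \<mm>_power_ideal], of x k y] by (simp add: R_simps)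
  show "x \<in> ideal_power \<O> \<mm> k \<Longrightarrow> z * x \<in> ideal_power \<O> \<mm> k" using I_l_closed[of x z] by (simp add: R_simps)
  show "0 \<in> ideal_power \<O> \<mm> k"
    using additive_subgroup.zero_closed[OF ideal.axioms(1)[OF \<mm>_power_ideal], of k] by (simp add: R_simps)
qed

lemma \<mm>_power_mult: "x \<in> ideal_power \<O> \<mm> k \<Longrightarrow> y \<in> \<mm> \<Longrightarrow> x * y \<in> ideal_power \<O> \<mm> (Suc k)"
  using ideal_prod.prod[of x _ y \<mm> \<O>] by (simp add: \<mm>_power_Suc R_simps)

text \<open>
  The elements divisible by all powers of a generator \<open>\<pi>\<close> of the maximal ideal form an ideal that is
  stable under division by \<open>\<pi>\<close>. Its generator is therefore divisible by \<open>\<pi>\<close> times itself, and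
  vanishes.
\<close>

lemma \<mm>_power_inter: "(\<Inter>k. ideal_power \<O> \<mm> k) = {0}"
proof -
  interpret principal_domain \<O> by (rule R_principal)
  obtain \<pi> where \<pi>: "\<mm> = PIdl\<^bsub>\<O>\<^esub> \<pi>" using exists_gen[OF \<mm>_ideal] by blast
  then have \<pi>_mem: "x \<in> \<mm> \<longleftrightarrow> \<pi> dvd x" for x
    by (auto simp: cgenideal_def R_simps dvd_def mult.commute)
  have pow: "x \<in> ideal_power \<O> \<mm> k \<Longrightarrow> \<pi> ^ k dvd x" for x k
  proof (induction k arbitrary: x)
    case (Suc k)
    have "\<pi> ^ Suc k dvd x" if "x \<in> ideal_prod \<O> (ideal_power \<O> \<mm> k) \<mm>"
      using that
    proof (induction rule: ideal_prod.induct)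
      case (prod i j)
      then have "\<pi> ^ k * \<pi> dvd i * j" using Suc.IH[of i] \<pi>_mem by (intro mult_dvd_mono) auto
      then show ?case by (simp add: R_simps mult.commute)
    next
      case (sum s1 s2)
      then show ?case by (simp only: R_simps dvd_add)
    qed
    then show ?case using Suc.prems by (simp add: \<mm>_power_Suc)
  qed simp
  let ?I = "{x. \<forall>k. \<pi> ^ k dvd x}"
  have "ideal ?I \<O>"
  proof (rule idealI)
    show "subgroup ?I (add_monoid \<O>)"
    proof (rule group.subgroupI[OF a_group])
      fix a assume a: "a \<in> ?I"
      have "inv\<^bsub>add_monoid \<O>\<^esub> a = - a"
        using R_minus[of 0 a] by (simp add: a_minus_def a_inv_def R_simps)
      then show "inv\<^bsub>add_monoid \<O>\<^esub> a \<in> ?I" using a by simp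
    qed (auto simp: R_simps intro: exI[of _ 0])
  qed (auto simp: R_simps ring_axioms)
  then obtain c where c: "?I = PIdl\<^bsub>\<O>\<^esub> c" using exists_gen by blast
  then have c_mem: "(\<forall>k. \<pi> ^ k dvd x) \<longleftrightarrow> c dvd x" for x
    by (auto simp: cgenideal_def R_simps dvd_def mult.commute set_eq_iff)
  have "c = 0"
  proof (rule ccontr)
    assume "c \<noteq> 0"
    obtain c' where c': "c = \<pi> * c'" using c_mem[of c] by (metis dvdE dvd_refl power_one_right)
    then have "\<pi> \<noteq> 0" using \<open>c \<noteq> 0\<close> by auto
    have "\<pi> ^ k dvd c'" for k
    proof -
      have "\<pi> * \<pi> ^ k dvd \<pi> * c'" using c_mem[of c] c' by (metis dvd_refl power_Suc)
      then show ?thesis using \<open>\<pi> \<noteq> 0\<close> by simp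
    qed
    then obtain d where "c' = c * d" using c_mem[of c'] by auto
    then have "c * (1 - \<pi> * d) = 0" using c' by (simp add: algebra_simps)
    then have "1 = \<pi> * d" using \<open>c \<noteq> 0\<close> by simp
    then have "\<pi> dvd 1" by (rule dvdI)
    then show False using \<mm>_1 \<pi>_mem by blast
  qed
  have "x = 0" if "\<And>k. x \<in> ideal_power \<O> \<mm> k" for x
    using pow[OF that] c_mem[of x] \<open>c = 0\<close> by simp
  then show ?thesis using \<mm>_power_closed(3) by auto
qed

text \<open>
  Writing \<open>u = 1 - l\<close>, the equation becomes \<open>l = p + l\<^sup>2\<close>. On the maximal ideal the map
  \<open>y \<mapsto> p + y\<^sup>2\<close> is a contraction, since \<open>y\<^sup>2 - z\<^sup>2 = (y - z) (y + z)\<close>, and completeness provides its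
  fixed point.
\<close>

lemma quadratic_unit:
  assumes p: "of_nat p \<in> \<mm>"
  shows "\<exists>u::'a. u dvd 1 \<and> u * u = u - of_nat p"
proof -
  define z where "z = rec_nat (0::'a) (\<lambda>_ y. of_nat p + y * y)"
  have z: "z 0 = 0" "z (Suc k) = of_nat p + z k * z k" for k by (simp_all add: z_def)
  have z_mem: "z k \<in> \<mm>" for k
    by (induction k) (use p z \<mm>_0 \<mm>_add \<mm>_mult in auto)
  have minus: "x - y \<in> \<mm>" if "x \<in> \<mm>" "y \<in> \<mm>" for x y
    using that \<mm>_add[of x "- 1 * y"] \<mm>_mult[of y "- 1"] by simp
  have step: "z (Suc k) - z k \<in> ideal_power \<O> \<mm> k" for k
  proof (induction k)
    case (Suc k)
    have "z (Suc (Suc k)) - z (Suc k) = (z (Suc k) - z k) * (z (Suc k) + z k)"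
      by (simp add: z(2)[of "Suc k"] z(2)[of k] algebra_simps)
    then show ?case using \<mm>_power_mult[OF Suc] z_mem \<mm>_add by simp
  qed (simp add: \<mm>_power_0)
  have anti: "x \<in> ideal_power \<O> \<mm> k" if "x \<in> ideal_power \<O> \<mm> l" "k \<le> l" for x k l
  proof -
    have "ideal_power \<O> \<mm> (Suc j) \<subseteq> ideal_power \<O> \<mm> j" for j
    proof -
      interpret ring \<O> using \<mm>_ideal by (simp add: ideal_def)
      show ?thesis using ideal_prod_inter[OF \<mm>_power_ideal \<mm>_ideal] by (auto simp: \<mm>_power_Suc)
    qed
    then have "ideal_power \<O> \<mm> l \<subseteq> ideal_power \<O> \<mm> k" using lift_Suc_antimono_le[OF _ that(2)] by blast
    then show ?thesis using that by blast
  qed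
  have ahead: "z (k + d) - z k \<in> ideal_power \<O> \<mm> k" for k d
  proof (induction d)
    case (Suc d)
    show ?case using \<mm>_power_closed(1)[OF anti[OF step[of "k + d"], of k] Suc] by simp
  qed (simp add: \<mm>_power_closed)
  have "adic_Cauchy \<O> \<mm> z"
    unfolding adic_Cauchy_def R_minus
  proof (intro allI exI impI)
    fix k i j :: nat assume ij: "k \<le> i" "k \<le> j"
    have "z i - z j = (z (k + (i - k)) - z k) + - 1 * (z (k + (j - k)) - z k)" using ij by simp
    then show "z i - z j \<in> ideal_power \<O> \<mm> k"
      using \<mm>_power_closed ahead by metis
  qed
  then obtain l where l: "adic_tendsto \<O> \<mm> z l"
    using dvr by (auto simp: complete_dvr_finite_residue_field_def adic_complete_def R_simps)
  have "l - (of_nat p + l * l) \<in> ideal_power \<O> \<mm> k" for k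
  proof -
    obtain N where N: "\<And>i. i \<ge> N \<Longrightarrow> z i - l \<in> ideal_power \<O> \<mm> k"
      using l unfolding adic_tendsto_def R_minus by blast
    have e: "l - (of_nat p + l * l) = - 1 * (z (Suc N) - l) + (z N + l) * (z N - l)"
      by (simp add: z algebra_simps)
    show ?thesis unfolding e by (intro \<mm>_power_closed N) auto
  qed
  then have "l - (of_nat p + l * l) \<in> (\<Inter>k. ideal_power \<O> \<mm> k)" by blast
  then have "l - (of_nat p + l * l) = 0" unfolding \<mm>_power_inter by blast
  then have eq: "l = of_nat p + l * l" by (rule eq_iff_diff_eq_0[THEN iffD2])
  have "l \<in> \<mm>"
  proof -
    obtain N where "z N - l \<in> ideal_power \<O> \<mm> (Suc 0)"
      using l unfolding adic_tendsto_def R_minus by blast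
    moreover have "ideal_power \<O> \<mm> (Suc 0) \<subseteq> \<mm>"
    proof -
      interpret ring \<O> using \<mm>_ideal by (simp add: ideal_def)
      show ?thesis using ideal_prod_inter[OF \<mm>_power_ideal \<mm>_ideal] by (auto simp: \<mm>_power_Suc)
    qed
    ultimately show ?thesis using minus[OF z_mem[of N]] by fastforce
  qed
  then have "1 - l \<notin> \<mm>" using \<mm>_add[of "1 - l" l] \<mm>_1 by auto
  moreover have "(1 - l) * (1 - l) = (1 - l) - of_nat p"
    using eq by (simp add: algebra_simps)
  ultimately show ?thesis using unit_if_not_in_\<mm> by blast
qed

lemma unit_Suc_of_\<mm>: "of_nat p \<in> \<mm> \<Longrightarrow> of_nat (Suc p) dvd (1::'a)"
  using unit_if_not_in_\<mm>[of "of_nat (Suc p)"] \<mm>_add[of "of_nat (Suc p)" "- 1 * of_nat p"] \<mm>_mult[of "of_nat p" "- 1"] \<mm>_1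
  by auto

lemma dvr_facts:
  obtains p u where "p \<ge> 2" "of_nat (Suc p) dvd (1::'a)" "u dvd (1::'a)" "u * u = u - of_nat p"
  using nat_in_\<mm> quadratic_unit unit_Suc_of_\<mm> by blast

end

section \<open>Elementary, diagonal and monomial matrices over a local ring\<close>

fun elementary_products :: "nat \<Rightarrow> nat \<Rightarrow> 'a::comm_ring_1 mat set" where
  "elementary_products n 0 = {1\<^sub>m n}"
| "elementary_products n (Suc N) = elementary_products n N \<union>
     {addrow_mat n x k l * B | x k l B. k < n \<and> l < n \<and> k \<noteq> l \<and> B \<in> elementary_products n N}"

lemma elementary_products_addrow:
  assumes A: "A \<in> carrier_mat n n" and kl: "k < n" "l < n" "k \<noteq> l"
    and "addrow x k l A \<in> elementary_products n N"
  shows "A \<in> elementary_products n (Suc N)"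
proof -
  have "addrow_mat n (- x) k l * addrow x k l A = (addrow_mat n (- x) k l * addrow_mat n x k l) * A"
    using A kl by (simp add: addrow_mat[of A n n l] assoc_mult_mat[of _ n n _ n _ n])
  also have "addrow_mat n (- x) k l * addrow_mat n x k l = 1\<^sub>m n"
    using addrow_mat_inv[OF kl, of "- x"] by simp
  finally have "A = addrow_mat n (- x) k l * addrow x k l A" using A by simp
  then show ?thesis using kl assms(5) by auto
qed

definition unit_columns :: "'a::comm_ring_1 mat \<Rightarrow> nat \<Rightarrow> bool" where
  "unit_columns A k \<longleftrightarrow> (\<forall>i<dim_row A. \<forall>j<k. A $$ (i, j) = (if i = j then 1 else 0))"

lemma sum_dvd_1_imp:
  fixes f :: "'b \<Rightarrow> 'a::comm_ring_1"
  assumes local: "\<And>x y :: 'a. x + y dvd 1 \<Longrightarrow> x dvd 1 \<or> y dvd 1"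
    and "finite I" "sum f I dvd 1" "\<not> (0::'a) dvd 1"
  shows "\<exists>i\<in>I. f i dvd 1"
  using assms(2,3,4)
proof (induction I rule: finite_induct)
  case (insert i I)
  then show ?case using local[of "f i" "sum f I"] by auto
qed simp

text \<open>
  The inverse of \<open>A\<close> has the same first \<open>k\<close> columns as \<open>A\<close>, so the diagonal entry at \<open>k\<close> of the product
  of the two expresses 1 as a combination of the entries of column \<open>k\<close> from row \<open>k\<close> on. In a local ring
  one of the summands is a unit.
\<close>

lemma exists_unit_below:
  fixes A :: "'a::idom mat"
  assumes local: "\<And>x y :: 'a. x + y dvd 1 \<Longrightarrow> x dvd 1 \<or> y dvd 1"
    and A: "A \<in> carrier_mat n n" "det A = 1" and k: "k < n" "unit_columns A k"
  shows "\<exists>i. k \<le> i \<and> i < n \<and> A $$ (i, k) dvd 1"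
proof -
  define B where "B = adj_mat A"
  have B: "B \<in> carrier_mat n n" "B * A = 1\<^sub>m n"
    using adj_mat[OF A(1)] A(2) by (auto simp: B_def)
  have BA: "(\<Sum>l<n. B $$ (i, l) * A $$ (l, j)) = (if i = j then 1 else 0)" if "i < n" "j < n" for i j
  proof -
    have "(B * A) $$ (i, j) = (\<Sum>l<n. B $$ (i, l) * A $$ (l, j))"
      using A B(1) that by (simp add: scalar_prod_def lessThan_atLeast0)
    then show ?thesis using B(2) that by simp
  qed
  have B0: "B $$ (k, j) = 0" if "j < k" for j
  proof -
    have "(\<Sum>l<n. B $$ (k, l) * A $$ (l, j)) = (\<Sum>l<n. if l = j then B $$ (k, l) else 0)"
      using that k A(1) by (intro sum.cong) (auto simp: unit_columns_def)
    also have "\<dots> = B $$ (k, j)" using that k by simp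
    finally show ?thesis using BA[of k j] that k by simp
  qed
  have "(\<Sum>l<n. B $$ (k, l) * A $$ (l, k)) dvd 1" using BA[of k k] k by simp
  then have "\<exists>i\<in>{..<n}. B $$ (k, i) * A $$ (i, k) dvd 1"
    by (intro sum_dvd_1_imp[OF local]) auto
  then obtain i where i: "i < n" "B $$ (k, i) * A $$ (i, k) dvd 1" by blast
  then have "i \<ge> k" using B0[of i] by (cases "i < k") auto
  then show ?thesis using i dvd_mult_right by blast
qed

text \<open>
  Gaussian elimination column by column, in which the number of steps depends on \<open>n\<close> only. A unit in
  column \<open>k\<close> at or below the diagonal is used to produce the entry 1 on the diagonal, and then to clear
  the column. In the last column the diagonal entry is 1 because the determinant is.
\<close>

lemma bounded_elementary_generation:
  fixes n :: nat
  assumes local: "\<And>x y :: 'a::idom. x + y dvd 1 \<Longrightarrow> x dvd 1 \<or> y dvd 1"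
  shows "\<exists>N. \<forall>A :: 'a mat. A \<in> carrier_mat n n \<longrightarrow> det A = 1 \<longrightarrow> A \<in> elementary_products n N"
proof -
  have "\<exists>N. \<forall>A :: 'a mat. A \<in> carrier_mat n n \<longrightarrow> det A = 1 \<longrightarrow> unit_columns A (n - m) \<longrightarrow>
      A \<in> elementary_products n N" if "m \<le> n" for m
    using that
  proof (induction m)
    case 0
    have "A = 1\<^sub>m n" if "A \<in> carrier_mat n n" "unit_columns A n" for A :: "'a mat"
      using that by (intro eq_matI) (auto simp: unit_columns_def)
    then show ?case by (intro exI[of _ 0]) auto
  next
    case (Suc m)
    define k where "k = n - Suc m"
    have k: "k < n" "n - m = Suc k" using Suc.prems by (auto simp: k_def)
    obtain N where N: "\<And>A :: 'a mat. A \<in> carrier_mat n n \<Longrightarrow> det A = 1 \<Longrightarrow> unit_columns A (Suc k) \<Longrightarrow>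
      A \<in> elementary_products n N" using Suc k by auto
    have addrow_ok: "addrow x i l A \<in> carrier_mat n n" "det (addrow x i l A) = 1" "unit_columns (addrow x i l A) k"
      if A: "A \<in> carrier_mat n n" "det A = 1" "unit_columns A k" and il: "i < n" "l < n" "i \<noteq> l" "k \<le> l"
      for A :: "'a mat" and x i l
      using that det_addrow[OF il(2,3) A(1)] by (auto simp: unit_columns_def)
    have clear: "A \<in> elementary_products n (N + r)"
      if "r \<le> n" "A \<in> carrier_mat n n" "det A = 1" "unit_columns A k" "A $$ (k, k) = 1"
        "\<And>i. r \<le> i \<Longrightarrow> i < n \<Longrightarrow> i \<noteq> k \<Longrightarrow> A $$ (i, k) = 0" for r and A :: "'a mat"
      using that
    proof (induction r arbitrary: A)
      case 0
      have "unit_columns A (Suc k)"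
        using 0 k unfolding unit_columns_def by (auto simp: less_Suc_eq)
      then show ?case using N 0 by simp
    next
      case (Suc r)
      show ?case
      proof (cases "r = k")
        case True
        then have "A \<in> elementary_products n (N + r)"
          using Suc.prems by (intro Suc.IH) (metis le_antisym not_less_eq_eq Suc_leD)+
        then show ?thesis by simp
      next
        case False
        let ?A = "addrow (- A $$ (r, k)) r k A"
        have r: "r < n" using Suc.prems by simp
        have ok: "?A \<in> carrier_mat n n" "det ?A = 1" "unit_columns ?A k"
          using addrow_ok[OF Suc.prems(2-4) r k(1) False] by auto
        have "?A \<in> elementary_products n (N + r)"
        proof (rule Suc.IH[OF _ ok])
          show "?A $$ (k, k) = 1" using False Suc.prems k r by simp
          show "?A $$ (i, k) = 0" if "r \<le> i" "i < n" "i \<noteq> k" for i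
            using that Suc.prems k r by (cases "i = r") auto
        qed (use r in simp)
        then show ?thesis using elementary_products_addrow[OF Suc.prems(2) r k(1) False] by simp
      qed
    qed
    have pivot_1: "A \<in> elementary_products n (N + n)"
      if "A \<in> carrier_mat n n" "det A = 1" "unit_columns A k" "A $$ (k, k) = 1" for A :: "'a mat"
      using clear[of n A] that by auto
    \<comment> \<open>A unit below the diagonal lets one row operation put 1 on the diagonal.\<close>
    have lower_unit: "A \<in> elementary_products n (Suc (N + n))"
      if A: "A \<in> carrier_mat n n" "det A = 1" "unit_columns A k" and i: "k < i" "i < n" "A $$ (i, k) dvd 1"
      for i and A :: "'a mat"
    proof -
      obtain u where u: "1 = A $$ (i, k) * u" using i(3) by (rule dvdE)
      let ?A = "addrow ((1 - A $$ (k, k)) * u) k i A"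
      have ki: "k \<noteq> i" "k \<le> i" using i by auto
      have "?A $$ (k, k) = (1 - A $$ (k, k)) * (A $$ (i, k) * u) + A $$ (k, k)"
        using A k by (simp add: mult_ac)
      then have "?A $$ (k, k) = 1" by (simp add: u[symmetric])
      then have "?A \<in> elementary_products n (N + n)"
        using addrow_ok[OF A k(1) i(2) ki] by (intro pivot_1)
      then show ?thesis using elementary_products_addrow[OF A(1) k(1) i(2) ki(1)] by blast
    qed
    have "A \<in> elementary_products n (Suc (Suc (N + n)))"
      if A: "A \<in> carrier_mat n n" "det A = 1" "unit_columns A k" for A :: "'a mat"
    proof (cases "Suc k < n")
      case True
      obtain i where i: "k \<le> i" "i < n" "A $$ (i, k) dvd 1"
        using exists_unit_below[OF local A(1,2) k(1) A(3)] by blast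
      show ?thesis
      proof (cases "i = k")
        case False
        then show ?thesis using lower_unit[OF A, of i] i by simp
      next
        case eq: True
        obtain u where u: "1 = A $$ (k, k) * u" using i(3) unfolding eq by (rule dvdE)
        \<comment> \<open>The only unit is on the diagonal: first create a unit below it.\<close>
        let ?A = "addrow ((1 - A $$ (Suc k, k)) * u) (Suc k) k A"
        have "?A $$ (Suc k, k) = (1 - A $$ (Suc k, k)) * (A $$ (k, k) * u) + A $$ (Suc k, k)"
          using A True by (simp add: mult_ac)
        then have "?A $$ (Suc k, k) = 1" by (simp add: u[symmetric])
        then have "?A \<in> elementary_products n (Suc (N + n))"
          using addrow_ok[OF A True k(1)] True by (intro lower_unit[where i = "Suc k"]) auto
        then show ?thesis using elementary_products_addrow[OF A(1) True k(1)] n_not_Suc_n by metis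
      qed
    next
      case False
      then have n: "n = Suc k" using k by simp
      have "upper_triangular A" using A n unfolding upper_triangular_def unit_columns_def by auto
      then have "det A = (\<Prod>i<n. A $$ (i, i))"
        using det_upper_triangular[OF _ A(1)] prod_list_diag_prod[of A] A(1) by (simp add: lessThan_atLeast0)
      also have "\<dots> = (\<Prod>i<k. A $$ (i, i)) * A $$ (k, k)" by (simp add: n)
      also have "(\<Prod>i<k. A $$ (i, i)) = 1" using A k by (intro prod.neutral) (auto simp: unit_columns_def)
      finally have "A \<in> elementary_products n (N + n)" using A by (intro pivot_1) auto
      then show ?thesis by simp
    qed
    then show ?case unfolding k_def by blast
  qed
  from this[of n] show ?thesis by (auto simp: unit_columns_def)
qed


text \<open>
  For \<open>w\<close> inverse to \<open>v\<close> the exponents make the determinant 1, and they let permutations of the rows permute the family. For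
  \<open>i \<ge> n\<close> the value is the identity, so that the family is indexed by a whole type.
\<close>

definition torus :: "nat \<Rightarrow> 'a::comm_ring_1 \<Rightarrow> 'a \<Rightarrow> nat \<Rightarrow> 'a mat" where
  "torus n v w i = mat_diag n (\<lambda>r. if i < n then if r = i then v ^ (n - 1) else w else 1)"

text \<open>
  The permutation matrix of a transposition, with one sign changed to have determinant 1.
\<close>

definition weyl :: "nat \<Rightarrow> nat \<Rightarrow> nat \<Rightarrow> 'a::comm_ring_1 mat" where
  "weyl n i j = mat_diag n (\<lambda>r. if r = i then - 1 else 1) * swaprows_mat n i j"

lemma det_mat_diag: "det (mat_diag n f :: 'a::comm_ring_1 mat) = (\<Prod>i<n. f i)"
proof -
  have "det (mat_diag n f) = prod_list (diag_mat (mat_diag n f))"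
    by (rule det_upper_triangular[of _ n]) (auto simp: mat_diag_def upper_triangular_def)
  also have "\<dots> = (\<Prod>i<n. f i)"
    unfolding prod_list_diag_prod by (intro prod.cong) (auto simp: mat_diag_def lessThan_atLeast0)
  finally show ?thesis .
qed

lemma torus_SL:
  assumes "v * w = 1"
  shows "torus n v w i \<in> carrier (SL n)"
proof -
  have "(\<Prod>r<n. if r = i then v ^ (n - 1) else w) = 1" if i: "i < n"
  proof -
    have "(\<Prod>r<n. if r = i then v ^ (n - 1) else w) =
        v ^ (n - 1) * (\<Prod>r\<in>{..<n} - {i}. if r = i then v ^ (n - 1) else w)"
      using i by (subst prod.remove[of _ i]) auto
    also have "(\<Prod>r\<in>{..<n} - {i}. if r = i then v ^ (n - 1) else w) = (\<Prod>r\<in>{..<n} - {i}. w)"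
      by (intro prod.cong) auto
    also have "\<dots> = w ^ (n - 1)" using i by simp
    finally show ?thesis using assms by (simp add: power_mult_distrib[symmetric])
  qed
  then show ?thesis unfolding SL_def torus_def by (cases "i < n") (simp_all add: det_mat_diag)
qed

lemma torus_commute: "torus n v w i * torus n v' w' j = torus n v' w' j * torus n v w i"
  by (simp add: torus_def mult.commute)

lemma torus_inverse: "v * w = 1 \<Longrightarrow> torus n v w i * torus n w v i = 1\<^sub>m n"
  unfolding torus_def mat_diag_diag
  by (intro eq_matI) (auto simp: mat_diag_def mult.commute power_mult_distrib[symmetric])

lemma mat_diag_addrow:
  fixes f :: "nat \<Rightarrow> 'a::comm_ring_1"
  assumes "f k = a * f l" "k < n" "l < n" "k \<noteq> l"
  shows "mat_diag n f * addrow_mat n x k l = addrow_mat n (a * x) k l * mat_diag n f"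
  using assms by (subst mat_diag_mult_left[of _ n n] mat_diag_mult_right[of _ n n]; simp)+
    (intro eq_matI; auto simp: mult_ac)

text \<open>
  The factor by which conjugation with \<open>torus n v w i\<close> multiplies the parameter of the root group at
  position \<open>(k, l)\<close>.
\<close>

definition root_factor :: "nat \<Rightarrow> 'a::comm_ring_1 \<Rightarrow> 'a \<Rightarrow> nat \<Rightarrow> nat \<Rightarrow> nat \<Rightarrow> 'a" where
  "root_factor n v w k l i = (if i = k then v ^ n else if i = l then w ^ n else 1)"

lemma torus_addrow:
  assumes "v * w = 1" "k < n" "l < n" "k \<noteq> l"
  shows "torus n v w i * addrow_mat n x k l = addrow_mat n (root_factor n v w k l i * x) k l * torus n v w i"
proof -
  obtain m where m: "n = Suc m" using assms by (cases n) auto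
  have "w * v ^ n = v ^ m" using assms by (simp add: m mult.assoc[symmetric] mult.commute[of w])
  moreover have "v ^ (n - 1) * w ^ n = w" using assms by (simp add: m mult.left_commute power_mult_distrib[symmetric])
  ultimately show ?thesis using assms unfolding torus_def
    by (intro mat_diag_addrow) (auto simp: root_factor_def m mult_ac)
qed

lemma weyl_SL: "i < n \<Longrightarrow> j < n \<Longrightarrow> i \<noteq> j \<Longrightarrow> weyl n i j \<in> carrier (SL n)"
proof -
  assume ij: "i < n" "j < n" "i \<noteq> j"
  have "det (mat_diag n (\<lambda>r. if r = i then - 1 else 1) :: 'a mat) = - 1"
    using ij by (simp add: det_mat_diag)
  then show ?thesis using ij unfolding SL_def weyl_def
    by (auto simp: det_mult[of _ n] det_swaprows_mat intro!: mult_carrier_mat[of _ n n])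
qed

lemma weyl_mat_diag:
  assumes "i < n" "j < n"
  shows "weyl n i j * mat_diag n f = mat_diag n (f \<circ> transpose i j) * weyl n i j"
proof -
  let ?S = "swaprows_mat n i j :: 'a mat" and ?s = "mat_diag n (\<lambda>r. if r = i then - 1 else 1) :: 'a mat"
  have 1: "?S * mat_diag n f = mat_diag n (f \<circ> transpose i j) * ?S"
    using assms by (subst mat_diag_mult_left[of _ n n] mat_diag_mult_right[of _ n n]; simp)+
      (intro eq_matI; auto simp: transpose_def)
  have "weyl n i j * mat_diag n f = ?s * (?S * mat_diag n f)"
    unfolding weyl_def by (rule assoc_mult_mat[of _ n n _ n _ n]) auto
  also have "\<dots> = (?s * mat_diag n (f \<circ> transpose i j)) * ?S"
    unfolding 1 by (rule assoc_mult_mat[of _ n n _ n _ n, symmetric]) auto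
  also have "?s * mat_diag n (f \<circ> transpose i j) = mat_diag n (f \<circ> transpose i j) * ?s"
    by (simp add: mult.commute)
  also have "\<dots> * ?S = mat_diag n (f \<circ> transpose i j) * weyl n i j"
    unfolding weyl_def by (rule assoc_mult_mat[of _ n n _ n _ n]) auto
  finally show ?thesis .
qed

lemma weyl_torus:
  assumes ij: "i < n" "j < n"
  shows "weyl n i j * torus n v w (transpose i j m) = torus n v w m * weyl n i j"
proof -
  have "transpose i j m < n \<longleftrightarrow> m < n" using ij by (auto simp: transpose_def)
  then have "(\<lambda>r. if transpose i j m < n then if r = transpose i j m then v ^ (n - 1) else w else 1) \<circ> transpose i j
      = (\<lambda>r. if m < n then if r = m then v ^ (n - 1) else w else 1)"
    by (auto simp: fun_eq_iff transpose_eq_iff)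
  then show ?thesis unfolding torus_def weyl_mat_diag[OF ij] by simp
qed

lemma addrow_mat_add:
  assumes "k < n" "l < n" "k \<noteq> l"
  shows "addrow_mat n x k l * addrow_mat n y k l = addrow_mat n (x + y) k l"
  using assms by (subst addrow_mat[symmetric, of _ n n]; simp) (intro eq_matI; auto)

lemma addrow_mat_SL: "k \<noteq> l \<Longrightarrow> addrow_mat n x k l \<in> carrier (SL n)"
  by (simp add: SL_def det_addrow_mat)

section \<open>Complex vectors with bounded support\<close>

definition fun_scale :: "complex \<Rightarrow> (nat \<Rightarrow> complex) \<Rightarrow> nat \<Rightarrow> complex" where
  "fun_scale c f = (\<lambda>i. c * f i)"

text \<open>
  Vectors of length \<open>D\<close> are modelled as functions supported below \<open>D\<close>, since \<open>D\<close> is a variable.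
\<close>

definition coord_space :: "nat \<Rightarrow> (nat \<Rightarrow> complex) set" where
  "coord_space D = {f. \<forall>i\<ge>D. f i = 0}"

definition coord_basis :: "nat \<Rightarrow> (nat \<Rightarrow> complex) set" where
  "coord_basis D = (\<lambda>j i. if i = j then 1 else 0) ` {..<D}"

lemma card_coord_basis: "card (coord_basis D) \<le> D"
  unfolding coord_basis_def using card_image_le[of "{..<D}"] by simp

interpretation coords: vector_space fun_scale
  by unfold_locales (auto simp: fun_scale_def fun_eq_iff algebra_simps)

interpretation coords: bounded_space fun_scale "coord_space D" "coord_basis D" for D
proof
  show "coords.subspace (coord_space D)"
    by (auto simp: coords.subspace_def coord_space_def fun_scale_def)
  show "finite (coord_basis D)" by (simp add: coord_basis_def)
  show "coord_space D \<subseteq> coords.span (coord_basis D)"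
  proof
    fix f assume f: "f \<in> coord_space D"
    let ?e = "\<lambda>j i. if i = j then 1 else 0 :: complex"
    have "(\<Sum>j<m. fun_scale (f j) (?e j)) = (\<lambda>i. if i < m then f i else 0)" for m
    proof (induction m)
      case (Suc m)
      then show ?case by (auto simp: fun_eq_iff fun_scale_def less_Suc_eq)
    qed (simp add: fun_eq_iff)
    then have "f = (\<Sum>j<D. fun_scale (f j) (?e j))" using f by (auto simp: coord_space_def fun_eq_iff)
    also have "\<dots> \<in> coords.span (coord_basis D)"
      by (intro coords.span_sum coords.span_scale coords.span_base) (auto simp: coord_basis_def)
    finally show "f \<in> coords.span (coord_basis D)" .
  qed
qed

definition mat_act :: "nat \<Rightarrow> complex mat \<Rightarrow> (nat \<Rightarrow> complex) \<Rightarrow> nat \<Rightarrow> complex" where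
  "mat_act D M f = (\<lambda>i. if i < D then \<Sum>j<D. M $$ (i, j) * f j else 0)"

lemma mat_act_mult:
  assumes "M \<in> carrier_mat D D" "N \<in> carrier_mat D D"
  shows "mat_act D (M * N) f = mat_act D M (mat_act D N f)"
proof
  fix i
  have "(\<Sum>j<D. (M * N) $$ (i, j) * f j) = (\<Sum>j<D. M $$ (i, j) * (\<Sum>k<D. N $$ (j, k) * f k))" if "i < D"
  proof -
    have "(\<Sum>j<D. (M * N) $$ (i, j) * f j) = (\<Sum>j<D. \<Sum>l<D. M $$ (i, l) * N $$ (l, j) * f j)"
      using assms that by (simp add: scalar_prod_def lessThan_atLeast0 sum_distrib_right)
    also have "\<dots> = (\<Sum>l<D. \<Sum>j<D. M $$ (i, l) * N $$ (l, j) * f j)" by (rule sum.swap)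
    finally show ?thesis by (simp add: sum_distrib_left mult.assoc)
  qed
  then show "mat_act D (M * N) f i = mat_act D M (mat_act D N f) i" by (simp add: mat_act_def)
qed

lemma mat_act_one: "f \<in> coord_space D \<Longrightarrow> mat_act D (1\<^sub>m D) f = f"
proof
  fix i assume f: "f \<in> coord_space D"
  have "(\<Sum>j<D. 1\<^sub>m D $$ (i, j) * f j) = (\<Sum>j<D. if j = i then f j else 0)" if "i < D"
    using that by (intro sum.cong) auto
  then show "mat_act D (1\<^sub>m D) f i = f i" using f by (auto simp: mat_act_def coord_space_def)
qed

lemma mat_act_operator: "coords.operator D (mat_act D M)"
  unfolding coords.operator_def
proof (intro conjI allI ballI)
  show "mat_act D M (f + g) = mat_act D M f + mat_act D M g" for f g
    by (auto simp: mat_act_def fun_eq_iff distrib_left sum.distrib)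
  show "mat_act D M (fun_scale c f) = fun_scale c (mat_act D M f)" for c f
    by (auto simp: mat_act_def fun_scale_def fun_eq_iff sum_distrib_left mult_ac)
  show "mat_act D M f \<in> coord_space D" for f
    by (simp add: mat_act_def coord_space_def)
qed

lemma mat_act_inj:
  assumes "M \<in> carrier_mat D D" "N \<in> carrier_mat D D" "\<And>f. f \<in> coord_space D \<Longrightarrow> mat_act D M f = mat_act D N f"
  shows "M = N"
proof (rule eq_matI)
  fix i j assume ij: "i < dim_row N" "j < dim_col N"
  let ?e = "\<lambda>k. if k = j then 1 else 0 :: complex"
  have "mat_act D A ?e i = A $$ (i, j)" for A
  proof -
    have "(\<Sum>k<D. A $$ (i, k) * ?e k) = (\<Sum>k<D. if k = j then A $$ (i, k) else 0)"
      by (intro sum.cong) auto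
    then show ?thesis using ij assms(2) by (simp add: mat_act_def)
  qed
  moreover have "?e \<in> coord_space D" using ij assms(2) by (auto simp: coord_space_def)
  ultimately show "M $$ (i, j) = N $$ (i, j)" using assms(3) by metis
qed (use assms in auto)

lemma mat_act_cnj:
  "R \<in> carrier_mat D D \<Longrightarrow>
    mat_act D (map_mat complex_of_real R) (cnj \<circ> f) = cnj \<circ> mat_act D (map_mat complex_of_real R) f"
  by (auto simp: mat_act_def fun_eq_iff cnj_sum intro!: sum.cong)

lemma SL_mult: "g \<in> carrier (SL n) \<Longrightarrow> h \<in> carrier (SL n) \<Longrightarrow> g * h \<in> carrier (SL n)"
  by (auto simp: SL_def det_mult[of _ n] intro!: mult_carrier_mat[of _ n n])

lemma SL_one: "1\<^sub>m n \<in> carrier (SL n)"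
  by (simp add: SL_def)

section \<open>Real representations of the special linear group\<close>

locale real_representation =
  fixes n D :: nat and \<phi> :: "'a::idom mat \<Rightarrow> real mat"
  assumes hom: "\<phi> \<in> hom (SL n) (GL D)"
begin

lemma \<phi>_carrier: "g \<in> carrier (SL n) \<Longrightarrow> \<phi> g \<in> carrier_mat D D"
  using hom by (auto simp: hom_def GL_def units_of_def Units_def ring_mat_def Pi_iff)

lemma \<phi>_mult: "g \<in> carrier (SL n) \<Longrightarrow> h \<in> carrier (SL n) \<Longrightarrow> \<phi> (g * h) = \<phi> g * \<phi> h"
  using hom by (auto simp: hom_def GL_def SL_def units_of_def ring_mat_def)

lemma \<phi>_one: "\<phi> (1\<^sub>m n) = 1\<^sub>m D"
proof -
  let ?E = "\<phi> (1\<^sub>m n)"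
  have E: "?E \<in> carrier_mat D D" "?E * ?E = ?E"
    using \<phi>_carrier[OF SL_one] \<phi>_mult[OF SL_one SL_one] by simp_all
  have "?E \<in> Units (ring_mat TYPE(real) D ())"
    using hom SL_one by (auto simp: hom_def GL_def units_of_def Pi_iff)
  then obtain B where B: "B \<in> carrier_mat D D" "B * ?E = 1\<^sub>m D"
    by (auto simp: Units_def ring_mat_def)
  have "?E = (B * ?E) * ?E" using B E by simp
  also have "\<dots> = B * (?E * ?E)" using B E by (intro assoc_mult_mat) auto
  finally show ?thesis using B E by simp
qed

definition \<rho> :: "'a mat \<Rightarrow> (nat \<Rightarrow> complex) \<Rightarrow> nat \<Rightarrow> complex" where
  "\<rho> g = mat_act D (map_mat complex_of_real (\<phi> g))"

abbreviation V where "V \<equiv> coord_space D"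

lemma \<rho>_mult: "g \<in> carrier (SL n) \<Longrightarrow> h \<in> carrier (SL n) \<Longrightarrow> \<rho> (g * h) f = \<rho> g (\<rho> h f)"
  using \<phi>_carrier[of g] \<phi>_carrier[of h]
  by (simp add: \<rho>_def \<phi>_mult of_real_hom.mat_hom_mult[of _ D D _ D] mat_act_mult)

lemma \<rho>_one: "f \<in> V \<Longrightarrow> \<rho> (1\<^sub>m n) f = f"
  by (simp add: \<rho>_def \<phi>_one of_real_hom.mat_hom_one mat_act_one)

lemma \<rho>_operator: "coords.operator D (\<rho> g)"
  unfolding \<rho>_def by (rule mat_act_operator)

lemma \<rho>_V: "f \<in> V \<Longrightarrow> \<rho> g f \<in> V"
  using \<rho>_operator by (simp add: coords.operator_def)

lemma \<rho>_inj_on: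
  assumes "g \<in> carrier (SL n)" "h \<in> carrier (SL n)" "h * g = 1\<^sub>m n"
  shows "inj_on (\<rho> g) V"
  by (rule inj_on_inverseI[of _ "\<rho> h"]) (simp add: \<rho>_mult[symmetric] assms \<rho>_one)

lemma \<rho>_cnj: "g \<in> carrier (SL n) \<Longrightarrow> \<rho> g (cnj \<circ> f) = cnj \<circ> \<rho> g f"
  unfolding \<rho>_def by (rule mat_act_cnj[OF \<phi>_carrier])

lemma \<phi>_eqI:
  assumes "g \<in> carrier (SL n)" "h \<in> carrier (SL n)" "\<And>f. f \<in> V \<Longrightarrow> \<rho> g f = \<rho> h f"
  shows "\<phi> g = \<phi> h"
proof -
  have "map_mat complex_of_real (\<phi> g) = map_mat complex_of_real (\<phi> h)"
    using assms \<phi>_carrier by (intro mat_act_inj[of _ D]) (auto simp: \<rho>_def)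
  then show ?thesis by (metis of_real_hom.mat_hom_inj)
qed

definition shear :: "nat \<Rightarrow> nat \<Rightarrow> 'a \<Rightarrow> (nat \<Rightarrow> complex) \<Rightarrow> nat \<Rightarrow> complex" where
  "shear k l x = \<rho> (addrow_mat n x k l)"

context
  fixes k l :: nat
  assumes kl: "k < n" "l < n" "k \<noteq> l"
begin

lemma shear_add: "shear k l (x + y) f = shear k l x (shear k l y f)"
  using kl by (simp add: shear_def addrow_mat_add[symmetric] \<rho>_mult addrow_mat_SL)

lemma shear_zero: "f \<in> V \<Longrightarrow> shear k l 0 f = f"
proof -
  have "addrow_mat n 0 k l = (1\<^sub>m n :: 'a mat)" by (intro eq_matI) auto
  then show "f \<in> V \<Longrightarrow> shear k l 0 f = f" by (simp add: shear_def \<rho>_one)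
qed

lemma shear_commuting: "coords.commuting D (shear k l)"
  unfolding coords.commuting_def using \<rho>_operator shear_add by (metis shear_def add.commute)

lemma shear_weight:
  assumes "\<mu> \<in> coords.weights D (shear k l)"
  shows "\<mu> (x + y) = \<mu> x * \<mu> y" and "\<mu> 0 = 1"
  using coords.weight_multiplicative[OF shear_commuting shear_add shear_zero assms] by simp_all

lemma torus_shear:
  "v * w = 1 \<Longrightarrow> \<rho> (torus n v w i) (shear k l x f) = shear k l (root_factor n v w k l i * x) (\<rho> (torus n v w i) f)"
  using kl by (simp add: shear_def \<rho>_mult[symmetric] torus_SL addrow_mat_SL torus_addrow)

lemma torus_inj: "v * w = 1 \<Longrightarrow> inj_on (\<rho> (torus n v w i)) V"
  by (rule \<rho>_inj_on[of _ "torus n w v i"]) (simp_all add: torus_SL torus_inverse mult.commute)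

lemma torus_commuting: "v * w = 1 \<Longrightarrow> coords.commuting D (\<lambda>i. \<rho> (torus n v w i))"
  unfolding coords.commuting_def using \<rho>_operator
  by (simp add: \<rho>_mult[symmetric] torus_SL torus_commute[of n v w _ v w])

text \<open>
  On the complex space a real matrix is determined by its action, so finitely many operators mean
  finitely many values of \<open>\<phi>\<close>.
\<close>

lemma finite_root_group_image:
  assumes torsion: "\<And>\<mu>. \<mu> \<in> coords.weights D (shear k l) \<Longrightarrow> \<exists>M>0. \<forall>x. \<mu> x ^ M = 1"
    and trivial: "\<And>x f. x \<in> coords.unipotent_part D (shear k l) \<Longrightarrow> f \<in> V \<Longrightarrow> shear k l x f = f"
  shows "finite (range (\<lambda>x. \<phi> (addrow_mat n x k l)))"
proof -
  have fin: "finite (range (\<lambda>x. restrict (shear k l x) V))"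
    by (rule coords.finite_range_if_trivial_on_unipotent_part[OF shear_commuting shear_add shear_zero])
      (use torsion trivial in blast)+
  define c where "c r = \<phi> (addrow_mat n (SOME x. restrict (shear k l x) V = r) k l)" for r
  have "\<phi> (addrow_mat n x k l) = c (restrict (shear k l x) V)" for x
    unfolding c_def
  proof (rule \<phi>_eqI)
    let ?y = "SOME y. restrict (shear k l y) V = restrict (shear k l x) V"
    have eq: "restrict (shear k l x) V = restrict (shear k l ?y) V"
      by (rule sym, rule someI) simp
    show "\<rho> (addrow_mat n x k l) f = \<rho> (addrow_mat n ?y k l) f" if "f \<in> V" for f
      using fun_cong[OF eq, of f] that by (simp add: shear_def)
  qed (use kl addrow_mat_SL in auto)
  then have "range (\<lambda>x. \<phi> (addrow_mat n x k l)) \<subseteq> c ` range (\<lambda>x. restrict (shear k l x) V)" by blast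
  then show ?thesis by (rule finite_surj[OF fin])
qed

text \<open>
  In characteristic \<open>p > 0\<close> an additive map \<open>s\<close> from a subgroup of the ring to \<open>\<complex>\<close> satisfies
  \<open>p s(x) = s(p x) = 0\<close> and so vanishes. The cocycle lemma is applied with identity operators as \<open>T\<close>.
\<close>

lemma finite_root_group_image_char:
  assumes "CHAR('a) > 0"
  shows "finite (range (\<lambda>x. \<phi> (addrow_mat n x k l)))"
proof (rule finite_root_group_image)
  let ?p = "CHAR('a)"
  note mult = shear_weight
  show "\<exists>M>0. \<forall>x. \<mu> x ^ M = 1" if \<mu>: "\<mu> \<in> coords.weights D (shear k l)" for \<mu>
  proof -
    have "\<mu> (of_nat m * x) = \<mu> x ^ m" for m x
      by (induction m) (simp_all add: mult[OF \<mu>] distrib_right)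
    from this[of ?p] have "\<mu> x ^ ?p = 1" for x using mult(2)[OF \<mu>] by simp
    then show ?thesis using assms by blast
  qed
  fix x0 f0 assume x0: "x0 \<in> coords.unipotent_part D (shear k l)" and f0: "f0 \<in> V"
  show "shear k l x0 f0 = f0"
  proof (rule ccontr)
    assume ne: "shear k l x0 f0 \<noteq> f0"
    let ?K = "coords.unipotent_part D (shear k l)" and ?T = "\<lambda>(_::unit) f. f"
    have T: "coords.commuting D ?T" by (simp add: coords.commuting_def coords.operator_def)
    obtain s where s: "\<forall>x\<in>?K. \<forall>y\<in>?K. s (x + y) = s x + (s y :: complex)" and "\<exists>x\<in>?K. s x \<noteq> 0"
      using coords.additive_cocycle[OF shear_commuting shear_add shear_zero T, of "\<lambda>_. 1" x0 f0] x0 f0 ne by auto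
    then obtain x where x: "x \<in> ?K" "s x \<noteq> 0" by blast
    have K: "of_nat m * x \<in> ?K" for m
      using x(1) by (induction m) (auto simp: coords.unipotent_part_def mult distrib_right)
    have "s (of_nat m * x) = of_nat m * s x" for m
    proof (induction m)
      case 0
      have "0 \<in> ?K" using K[of 0] by simp
      then have "s (0 + 0) = s 0 + s 0" using s by blast
      then show ?case by simp
    next
      case (Suc m)
      have "s (x + of_nat m * x) = s x + s (of_nat m * x)" using s K x(1) by blast
      then show ?case using Suc by (simp add: algebra_simps)
    qed
    from this[of ?p] this[of 0] show False using x assms by simp
  qed
qed

text \<open>
  Diagonal matrices permute the weights of the root group, and hence preserve their common kernel; the
  inverse matrices give the reverse inclusion.
\<close>

lemma unipotent_part_root_invariant:
  assumes vw: "v * w = 1"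
  shows "(\<lambda>x. root_factor n v w k l i * x) ` coords.unipotent_part D (shear k l) = coords.unipotent_part D (shear k l)"
proof -
  let ?K = "coords.unipotent_part D (shear k l)"
  have inv: "root_factor n v w k l i * root_factor n w v k l i = 1" if "v * w = 1" for v w :: 'a
    using that by (simp add: root_factor_def power_mult_distrib[symmetric] mult.commute)
  have closed: "root_factor n v w k l i * x \<in> ?K" if vw: "v * w = 1" and x: "x \<in> ?K" for v w x
  proof -
    have "\<mu> (root_factor n v w k l i * x) = 1" if \<mu>: "\<mu> \<in> coords.weights D (shear k l)" for \<mu>
    proof -
      have wv: "w * v = 1" using vw by (simp add: mult.commute)
      have "(\<lambda>x. id (\<mu> (root_factor n v w k l i * x))) \<in> coords.weights D (shear k l)"
      proof (rule coords.weights_semilinear_image[OF \<mu>, where G = "\<rho> (torus n w v i)"])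
        show "\<rho> (torus n w v i) (shear k l (root_factor n v w k l i * x) f) = shear k l x (\<rho> (torus n w v i) f)" for x f
          using inv[OF wv] by (simp add: torus_shear[OF wv] mult.assoc[symmetric])
      qed (use \<rho>_operator torus_inj[OF wv] \<rho>_V in \<open>auto simp: coords.operator_def\<close>)
      then show ?thesis using x by (auto simp: coords.unipotent_part_def)
    qed
    then show ?thesis by (simp add: coords.unipotent_part_def)
  qed
  show ?thesis
  proof
    show "?K \<subseteq> (\<lambda>x. root_factor n v w k l i * x) ` ?K"
    proof
      fix x assume "x \<in> ?K"
      then have "root_factor n w v k l i * x \<in> ?K" using closed[of w v x] vw by (simp add: mult.commute)
      moreover have "x = root_factor n v w k l i * (root_factor n w v k l i * x)"
        using inv[OF vw] by (simp add: mult.assoc[symmetric])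
      ultimately show "x \<in> (\<lambda>x. root_factor n v w k l i * x) ` ?K" by blast
    qed
    show "(\<lambda>x. root_factor n v w k l i * x) ` ?K \<subseteq> ?K"
      by (rule image_subsetI) (rule closed[OF vw])
  qed
qed

lemma torus_weights_swap:
  assumes vw: "v * w = 1" and \<psi>: "\<psi> \<in> coords.weights D (\<lambda>i. \<rho> (torus n v w i))" and ij: "i < n" "j < n"
  shows "\<psi> \<circ> transpose i j \<in> coords.weights D (\<lambda>i. \<rho> (torus n v w i))"
proof (cases "i = j")
  case False
  define W where "W = (weyl n i j :: 'a mat)"
  have W: "W \<in> carrier (SL n)" using weyl_SL[OF ij False] by (simp add: W_def)
  have carr: "W \<in> carrier_mat n n" "adj_mat W \<in> carrier_mat n n" "det W = 1"
    using W adj_mat[of W n] by (auto simp: SL_def)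
  have inv: "adj_mat W * W = 1\<^sub>m n" "W * adj_mat W = 1\<^sub>m n" using adj_mat[OF carr(1)] carr by auto
  have "det W * det (adj_mat W) = 1" using inv(2) det_mult[OF carr(1,2)] by simp
  then have "adj_mat W \<in> carrier (SL n)" using carr by (simp add: SL_def)
  have "(\<lambda>m. id (\<psi> (transpose i j m))) \<in> coords.weights D (\<lambda>i. \<rho> (torus n v w i))"
  proof (rule coords.weights_semilinear_image[OF \<psi>, where G = "\<rho> W"])
    show "inj_on (\<rho> W) V" by (rule \<rho>_inj_on[OF W \<open>adj_mat W \<in> carrier (SL n)\<close> inv(1)])
    show "\<rho> W (\<rho> (torus n v w (transpose i j m)) f) = \<rho> (torus n v w m) (\<rho> W f)" for m f
      using weyl_torus[OF ij, of v w m] W torus_SL[OF vw] by (simp add: \<rho>_mult[symmetric] W_def)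
  qed (use \<rho>_operator \<rho>_V in \<open>auto simp: coords.operator_def\<close>)
  then show ?thesis by (simp add: comp_def)
qed (use \<psi> in simp)

lemma torus_weights_cnj:
  assumes vw: "v * w = 1" and \<psi>: "\<psi> \<in> coords.weights D (\<lambda>i. \<rho> (torus n v w i))"
  shows "cnj \<circ> \<psi> \<in> coords.weights D (\<lambda>i. \<rho> (torus n v w i))"
proof -
  have "(\<lambda>i. cnj (\<psi> i)) \<in> coords.weights D (\<lambda>i. \<rho> (torus n v w i))"
  proof (rule coords.weights_semilinear_image[OF \<psi>, where G = "\<lambda>f. cnj \<circ> f"])
    show "inj_on (\<lambda>f. cnj \<circ> f) V" by (rule inj_onI) (auto simp: fun_eq_iff)
    show "surj cnj" by (metis complex_cnj_cnj surjI)
    show "cnj \<circ> \<rho> (torus n v w i) f = \<rho> (torus n v w i) (cnj \<circ> f)" for i f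
      by (simp add: \<rho>_cnj torus_SL[OF vw])
  qed (auto simp: fun_scale_def coord_space_def fun_eq_iff)
  then show ?thesis by (simp add: comp_def)
qed

text \<open>
  The product of the matrices \<open>torus n v w i\<close> over \<open>i < n\<close> is the identity.
\<close>

lemma torus_weights_prod:
  assumes vw: "v * w = 1" and \<psi>: "\<psi> \<in> coords.weights D (\<lambda>i. \<rho> (torus n v w i))"
  shows "(\<Prod>i<n. \<psi> i) = 1"
proof -
  let ?e = "\<lambda>i r. if i < n then if r = i then v ^ (n - 1) else w else 1"
  define t where "t m = mat_diag n (\<lambda>r. \<Prod>i<m. ?e i r)" for m
  have t_Suc: "t (Suc m) = torus n v w m * t m" for m by (simp add: t_def torus_def mult.commute)
  have t_SL: "t m \<in> carrier (SL n)" for m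
    by (induction m) (simp_all only: t_Suc SL_mult torus_SL[OF vw], simp add: t_def SL_one)
  have "t n = 1\<^sub>m n"
  proof -
    have "(\<Prod>i<n. ?e i r) = 1" if r: "r < n" for r
    proof -
      have "(\<Prod>i<n. ?e i r) = v ^ (n - 1) * (\<Prod>i\<in>{..<n} - {r}. ?e i r)"
        using r by (subst prod.remove[of _ r]) auto
      also have "(\<Prod>i\<in>{..<n} - {r}. ?e i r) = (\<Prod>i\<in>{..<n} - {r}. w)" by (intro prod.cong) auto
      also have "\<dots> = w ^ (n - 1)" using r by simp
      finally show ?thesis using vw by (simp add: power_mult_distrib[symmetric])
    qed
    then show ?thesis unfolding t_def by (intro eq_matI) (auto simp: mat_diag_def)
  qed
  then show ?thesis
    using coords.weights_prod_eq_1[OF torus_commuting[OF vw] \<psi>, of "\<lambda>m. \<rho> (t m)" n]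
    by (simp add: t_Suc \<rho>_mult t_SL torus_SL[OF vw] \<rho>_one) (simp add: t_def \<rho>_one)
qed

text \<open>
  The equivariance of the cocycle \<open>s\<close> under \<open>torus n u u' k\<close> says \<open>s(u\<^sup>n x) = \<chi> s(x)\<close> with
  \<open>\<chi> = \<psi>' k / \<psi> k\<close>. As \<open>u\<close> and \<open>1 - u\<close> are the roots of \<open>X\<^sup>2 - X + p\<close>, the power \<open>u\<^sup>n\<close> satisfies the
  quadratic equation with trace \<open>power_trace p n\<close> and norm \<open>p\<^sup>n\<close>; its coefficients are integers, so
  additivity of \<open>s\<close> transfers the equation to \<open>\<chi>\<close>.
\<close>

lemma finite_root_group_image_dim:
  assumes D: "D < 2 * n" and p: "p \<ge> 2" "of_nat (Suc p) dvd (1::'a)"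
    and u: "u dvd (1::'a)" "u * u = u - of_nat p"
  shows "finite (range (\<lambda>x. \<phi> (addrow_mat n x k l)))"
proof (rule finite_root_group_image)
  obtain c :: 'a where c: "1 = of_nat (Suc p) * c" using p(2) by (rule dvdE)
  obtain u' where "1 = u * u'" using u(1) by (rule dvdE)
  then have u': "u * u' = 1" by simp
  let ?K = "coords.unipotent_part D (shear k l)"
  show "\<exists>M>0. \<forall>x. \<mu> x ^ M = 1" if \<mu>: "\<mu> \<in> coords.weights D (shear k l)" for \<mu>
  proof (rule coords.weights_torsion[OF shear_commuting shear_add shear_zero])
    \<comment> \<open>The integer \<open>p + 1\<close> is a unit; its torus element multiplies \<open>x\<close> by \<open>(p + 1)\<^sup>n\<close>.\<close>
    let ?T = "torus n (of_nat (Suc p)) c k"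
    have vw: "of_nat (Suc p) * c = 1" using c by simp
    show "Suc p ^ n \<ge> 2" using p(1) kl(1) self_le_power[of "Suc p" n] by simp
    show "c ^ n * of_nat (Suc p ^ n) = 1"
      using vw unfolding of_nat_power by (simp only: power_mult_distrib[symmetric] mult.commute[of c]) simp
    show "inj_on (\<rho> ?T) V" by (rule torus_inj[OF vw])
    show "\<rho> ?T (shear k l x f) = shear k l (of_nat (Suc p ^ n) * x) (\<rho> ?T f)" for x f
      unfolding torus_shear[OF vw] by (simp add: root_factor_def)
  qed (assumption, rule \<rho>_operator, rule \<mu>)
  fix x0 f0 assume x0: "x0 \<in> ?K" and f0: "f0 \<in> V"
  show "shear k l x0 f0 = f0"
  proof (rule ccontr)
    assume ne: "shear k l x0 f0 \<noteq> f0"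
    let ?T = "\<lambda>i. \<rho> (torus n u u' i)"
    let ?S = "coords.weights D ?T"
    obtain \<psi> \<psi>' s where \<psi>: "\<psi> \<in> ?S" "\<psi>' \<in> ?S"
      and s: "\<forall>x\<in>?K. \<forall>y\<in>?K. s (x + y) = s x + s y" "\<exists>x\<in>?K. s x \<noteq> 0"
      and equi: "\<forall>i. \<forall>x\<in>?K. \<psi>' i * s x = \<psi> i * s (root_factor n u u' k l i * x)"
      using coords.additive_cocycle[OF shear_commuting shear_add shear_zero torus_commuting[OF u'] torus_shear[OF u']
          unipotent_part_root_invariant[OF u'] x0 f0 ne] by blast
    note mult = shear_weight
    have K_add: "x + y \<in> ?K" if "x \<in> ?K" "y \<in> ?K" for x y
      using that by (auto simp: coords.unipotent_part_def mult)
    have K_0: "0 \<in> ?K" by (auto simp: coords.unipotent_part_def mult)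
    have K_minus: "- x \<in> ?K" if x: "x \<in> ?K" for x
    proof -
      have "\<mu> (- x) = 1" if \<mu>: "\<mu> \<in> coords.weights D (shear k l)" for \<mu>
      proof -
        have "\<mu> (x + - x) = \<mu> x * \<mu> (- x)" by (rule mult(1)[OF \<mu>])
        moreover have "\<mu> x = 1" using x \<mu> by (auto simp: coords.unipotent_part_def)
        ultimately show ?thesis using mult(2)[OF \<mu>] by simp
      qed
      then show ?thesis by (simp add: coords.unipotent_part_def)
    qed
    have s_0: "s 0 = 0" using s(1) K_0 by (metis add_cancel_right_right)
    have s_minus: "s (- x) = - s x" if "x \<in> ?K" for x
      using s(1) that K_minus[OF that] s_0 by (metis add.right_inverse add_eq_0_iff)
    have s_nat: "of_nat m * x \<in> ?K \<and> s (of_nat m * x) = of_nat m * s x" if x: "x \<in> ?K" for m x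
    proof (induction m)
      case (Suc m)
      have "s (x + of_nat m * x) = s x + s (of_nat m * x)" using s(1) Suc x by blast
      then show ?case using Suc K_add[OF x, of "of_nat m * x"] by (simp add: algebra_simps)
    qed (simp add: s_0 K_0)
    have s_int: "of_int m * x \<in> ?K \<and> s (of_int m * x) = of_int m * s x" if x: "x \<in> ?K" for m x
      using s_nat[OF x, of "nat m"] s_nat[OF x, of "nat (- m)"] K_minus[of "of_nat (nat (- m)) * x"]
        s_minus[of "of_nat (nat (- m)) * x"]
      by (cases "m \<ge> 0") (simp_all add: of_nat_nat)
    define \<chi> where "\<chi> = \<psi>' k / \<psi> k"
    have "\<psi> k \<noteq> 0" using torus_weights_prod[OF u' \<psi>(1)] kl(1) prod_zero[of "{..<n}" \<psi>] by auto
    then have \<psi>'_k: "\<psi>' k = \<chi> * \<psi> k" by (simp add: \<chi>_def)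
    have mult_u: "u ^ n * x \<in> ?K \<and> s (u ^ n * x) = \<chi> * s x" if x: "x \<in> ?K" for x
    proof
      have "root_factor n u u' k l k * x \<in> ?K" using unipotent_part_root_invariant[OF u', of k] x by blast
      then show "u ^ n * x \<in> ?K" by (simp add: root_factor_def)
      have "\<psi>' k * s x = \<psi> k * s (u ^ n * x)" using equi x by (auto simp: root_factor_def)
      then show "s (u ^ n * x) = \<chi> * s x" using \<open>\<psi> k \<noteq> 0\<close> by (simp add: \<chi>_def field_simps)
    qed
    let ?L = "power_trace (int p) n"
    have "u ^ n + (1 - u) ^ n = of_int ?L"
      by (rule power_trace) (use u(2) in \<open>simp_all add: algebra_simps\<close>)
    moreover have "u ^ n * (1 - u) ^ n = of_nat (p ^ n)"
      using u(2) by (simp add: power_mult_distrib[symmetric] right_diff_distrib)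
    ultimately have rel: "u ^ n * u ^ n + of_nat (p ^ n) = of_int ?L * u ^ n"
      by (metis distrib_left mult.commute)
    obtain x where x: "x \<in> ?K" "s x \<noteq> 0" using s(2) by blast
    have "u ^ n * (u ^ n * x) + of_nat (p ^ n) * x = of_int ?L * (u ^ n * x)"
      using arg_cong[OF rel, of "\<lambda>y. y * x"] by (simp only: distrib_right mult.assoc)
    then have "s (u ^ n * (u ^ n * x)) + s (of_nat (p ^ n) * x) = s (of_int ?L * (u ^ n * x))"
      using s(1) mult_u s_nat x(1) by metis
    then have "\<chi> * (\<chi> * s x) + of_nat (p ^ n) * s x = of_int ?L * (\<chi> * s x)"
      using mult_u[OF x(1)] mult_u[of "u ^ n * x"] s_nat[OF x(1), of "p ^ n"] s_int[of "u ^ n * x" ?L] by simp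
    then have "(\<chi>\<^sup>2 - of_int ?L * \<chi> + of_nat p ^ n) * s x = 0"
      by (simp add: algebra_simps power2_eq_square)
    then have quad: "\<chi>\<^sup>2 - of_int ?L * \<chi> + of_nat p ^ n = 0" using x(2) by simp
    have "2 * n \<le> card ?S"
    proof (rule card_weights_lower_bound[OF _ _ _ _ \<psi> kl(1) \<psi>'_k])
      show "finite ?S" by (rule coords.finite_weights[OF torus_commuting[OF u']])
      show "cmod \<chi> \<noteq> 1" "\<chi> ^ n \<notin> \<real>"
        using quadratic_root_power[OF p(1) _ quad] kl(1) by auto
    qed (use torus_weights_swap[OF u'] torus_weights_cnj[OF u'] torus_weights_prod[OF u'] in auto)
    also have "\<dots> \<le> D"
      using coords.card_weights[OF torus_commuting[OF u']] card_coord_basis[of D] by (rule order.trans)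
    finally show False using D by simp
  qed
qed

end

text \<open>
  Bounded generation writes the image as a finite product of the finite images of the root groups.
\<close>

lemma finite_image:
  assumes local: "\<And>x y :: 'a. x + y dvd 1 \<Longrightarrow> x dvd 1 \<or> y dvd 1"
    and root: "\<And>k l. k < n \<Longrightarrow> l < n \<Longrightarrow> k \<noteq> l \<Longrightarrow> finite (range (\<lambda>x. \<phi> (addrow_mat n x k l)))"
  shows "finite (\<phi> ` carrier (SL n))"
proof -
  have sub: "(elementary_products n N :: 'a mat set) \<subseteq> carrier (SL n)" for N
  proof (induction N)
    case (Suc N)
    have "addrow_mat n x k l * B \<in> carrier (SL n)" if "k \<noteq> l" "B \<in> elementary_products n N" for x k l and B :: "'a mat"
    proof (rule SL_mult[OF addrow_mat_SL[OF that(1)]])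
      show "B \<in> carrier (SL n)" using that(2) Suc by (rule rev_subsetD)
    qed
    then show ?case using Suc unfolding elementary_products.simps by blast
  qed (simp add: SL_one)
  have "finite (\<phi> ` elementary_products n N)" for N
  proof (induction N)
    case (Suc N)
    let ?I = "{(k, l). k < n \<and> l < n \<and> k \<noteq> l}"
    let ?F = "\<Union>(k, l)\<in>?I. (\<lambda>(a, b). a * b) ` (range (\<lambda>x. \<phi> (addrow_mat n x k l)) \<times> \<phi> ` elementary_products n N)"
    have "?I \<subseteq> {..<n} \<times> {..<n}" by auto
    then have "finite ?I" by (rule finite_subset) auto
    then have "finite ?F"
      by (rule finite_UN_I) (clarify, intro finite_imageI finite_cartesian_product root Suc)
    moreover have "\<phi> ` elementary_products n (Suc N) \<subseteq> \<phi> ` elementary_products n N \<union> ?F"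
    proof
      fix y assume "y \<in> \<phi> ` elementary_products n (Suc N)"
      then consider "y \<in> \<phi> ` elementary_products n N"
        | x k l B where "y = \<phi> (addrow_mat n x k l * B)" "(k, l) \<in> ?I" "B \<in> elementary_products n N"
        unfolding elementary_products.simps by blast
      then show "y \<in> \<phi> ` elementary_products n N \<union> ?F"
      proof cases
        case 2
        then have "B \<in> carrier (SL n)" "addrow_mat n x k l \<in> carrier (SL n)"
          using sub[of N] addrow_mat_SL[of k l] by auto
        then have "y = (\<lambda>(a, b). a * b) (\<phi> (addrow_mat n x k l), \<phi> B)" using 2(1) \<phi>_mult by simp
        moreover have "(\<phi> (addrow_mat n x k l), \<phi> B) \<in>
            range (\<lambda>x. \<phi> (addrow_mat n x k l)) \<times> \<phi> ` elementary_products n N"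
          using 2(3) by blast
        ultimately have "y \<in> (\<lambda>(a, b). a * b) `
            (range (\<lambda>x. \<phi> (addrow_mat n x k l)) \<times> \<phi> ` elementary_products n N)"
          by (rule image_eqI)
        then show ?thesis using 2(2) by (intro UnI2 UN_I[where a = "(k, l)"]) auto
      qed simp
    qed
    ultimately show ?case using Suc finite_subset by blast
  qed simp
  moreover obtain N where "\<forall>A :: 'a mat. A \<in> carrier_mat n n \<longrightarrow> det A = 1 \<longrightarrow> A \<in> elementary_products n N"
    using bounded_elementary_generation[OF local] by blast
  then have "carrier (SL n) \<subseteq> (elementary_products n N :: 'a mat set)" by (auto simp: SL_def)
  then have "\<phi> ` carrier (SL n) \<subseteq> \<phi> ` elementary_products n N" by (rule image_mono)
  ultimately show ?thesis using finite_subset by blast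
qed

end

section \<open>Finiteness of the image\<close>

theorem theorem1p1:
  assumes "complete_dvr_finite_residue_field (ring_of_type_algebra :: 'a :: idom ring)"
  shows "(\<forall>n D :: nat. \<forall>\<phi> :: 'a mat \<Rightarrow> real mat.
            n \<ge> 1 \<longrightarrow> D \<ge> 1 \<longrightarrow> D < 2 * n \<longrightarrow> \<phi> \<in> hom (SL n) (GL D) \<longrightarrow>
            finite (\<phi> ` carrier (SL n))) \<and>
         (CHAR('a) > 0 \<longrightarrow>
           (\<forall>n D :: nat. \<forall>\<phi> :: 'a mat \<Rightarrow> real mat.
              n \<ge> 1 \<longrightarrow> D \<ge> 1 \<longrightarrow> \<phi> \<in> hom (SL n) (GL D) \<longrightarrow>
              finite (\<phi> ` carrier (SL n))))"
proof (intro conjI allI impI)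
  obtain p and u :: 'a where pu: "p \<ge> 2" "of_nat (Suc p) dvd (1::'a)" "u dvd (1::'a)" "u * u = u - of_nat p"
    using dvr_facts[OF assms] by blast
  fix n D :: nat and \<phi> :: "'a mat \<Rightarrow> real mat"
  assume "\<phi> \<in> hom (SL n) (GL D)" and D: "D < 2 * n"
  then interpret real_representation n D \<phi> by unfold_locales
  show "finite (\<phi> ` carrier (SL n))"
    by (rule finite_image) (rule local_ring[OF assms], assumption, rule finite_root_group_image_dim[OF _ _ _ D pu])
next
  fix n D :: nat and \<phi> :: "'a mat \<Rightarrow> real mat"
  assume "\<phi> \<in> hom (SL n) (GL D)" and char: "CHAR('a) > 0"
  then interpret real_representation n D \<phi> by unfold_locales
  show "finite (\<phi> ` carrier (SL n))"
    by (rule finite_image) (rule local_ring[OF assms], assumption, rule finite_root_group_image_char[OF _ _ _ char])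
qed

end
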